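(* Let $(X,\mathcal{O}_X)$ be a locally ringed space, $\mathcal{U}$ a locally finite open cover of $X$, and $X_\bullet^{\mathcal{U}}$ its Čech nerve. Consider the $\Delta$-shaped diagram of model categories $[p]\mapsto\mathsf{Sh}(X_p^{\mathcal{U}})$, $(\alpha\colon[p]\to[q])\mapsto\big((X_\bullet^{\mathcal{U}}\alpha)^*\colon\mathsf{Sh}(X_p^{\mathcal{U}})\to\mathsf{Sh}(X_q^{\mathcal{U}})\big)$. Then there are equivalences of categories $$\mathrm{laxholim}_{[p]\in\Delta}\,\mathsf{Sh}(X_p^{\mathcal{U}})\simeq\mathsf{Sh}(X_\bullet^{\mathcal{U}})\qquad\text{and}\qquad\mathrm{holim}_{[p]\in\Delta}\,\mathsf{Sh}(X_p^{\mathcal{U}})\simeq\mathsf{Sh}^{\mathrm{cart}}(X_\bullet^{\mathcal{U}}).$$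
   Context: $\Delta$ is the simplex category. The Čech nerve $X_\bullet^{\mathcal{U}}$ is regarded as a simplicial locally ringed space with structure sheaves $\mathcal{O}_{X_p^{\mathcal{U}}}=\pi_p^{-1}\mathcal{O}_X$, where $\pi_p\colon X_p^{\mathcal{U}}\to X$ is the canonical map; for $\alpha\colon[p]\to[q]$ in $\Delta$ write $X_\bullet^{\mathcal{U}}\alpha\colon X_q^{\mathcal{U}}\to X_p^{\mathcal{U}}$. For a locally ringed space $Y$, $\mathsf{Sh}(Y)$ denotes here the category of cochain complexes of sheaves of $\mathcal{O}_Y$-modules, endowed with a (cofibrantly generated) model structure whose weak equivalences are the quasi-isomorphisms, and such that the pullback functors (of $\mathcal{O}$-modules) above are left Quillen. $\mathsf{Sh}(X_\bullet^{\mathcal{U}})$ is the category of cochain complexes of sheaves on the simplicial locally ringed space $X_\bullet^{\mathcal{U}}$. An object $\mathcal{F}^{\bullet,\star}$ consists of cochain complexes $\mathcal{F}^{p,\star}=(\mathcal{F}^{p,i},d^{p,i})_{i\in\mathbb{Z}}$ of sheaves of $\mathcal{O}_{X_p^{\mathcal{U}}}$-modules for each $p\in\mathbb{N}$, together with morphisms of complexes $\mathcal{F}^{\bullet,\star}\alpha\colon(X_\bullet^{\mathcal{U}}\alpha)^*\mathcal{F}^{p,\star}\to\mathcal{F}^{q,\star}$ for all $\alpha\colon[p]\to[q]$ in $\Delta$, functorial in the sense that $\mathcal{F}(\mathrm{id})=\mathrm{id}$ and $\mathcal{F}(\beta\circ\alpha)=\mathcal{F}(\beta)\circ\mathcal{F}(\alpha)$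 (with $\mathcal{F}(\alpha)$ pulled back along $X_\bullet^{\mathcal{U}}\beta$, and using canonical isomorphisms $(fg)^*\cong g^*f^*$ implicitly). Morphisms are families of morphisms of complexes $\varphi^p\colon\mathcal{F}^{p,\star}\to\mathcal{G}^{p,\star}$ commuting with the structure morphisms. Such an object is (weakly) cartesian if every $\mathcal{F}^{\bullet,\star}\alpha$ is a quasi-isomorphism; $\mathsf{Sh}^{\mathrm{cart}}(X_\bullet^{\mathcal{U}})$ is the full subcategory of cartesian objects. Let $\mathcal{D}$ be a small category. A $\mathcal{D}$-shaped diagram $M$ of model categories is the data of a model category $M_d$ for each $d\in\mathcal{D}$ and a functorial assignment of left Quillen functors $F_{d,e}^\theta\colon M_d\to M_e$ for all $\theta\colon d\to e$ in $\mathcal{D}$. If each $M_d$ is cofibrantly generated, $\mathrm{laxholim}_{d\in\mathcal{D}}M$ is the category whose objects consist of an object $m_d\in M_d$ for each $d\in\mathcal{D}$ and a morphism $u_{d,e}^\theta\colon F_{d,e}^\theta(m_d)\to m_e$ in $M_e$ for each $\theta\colon d\to e$, such that $u_{d,f}^{\eta\theta}=u_{e,f}^\eta\circ F_{e,f}^\eta(u_{d,e}^\theta)$ for all composable $\theta\colon d\to e$, $\eta\colon e\to f$, and $u_{d,d}^{\mathrm{id}}=\mathrm{id}$. Its morphisms $(m_d,u)\to(m'_d,u')$ are families of morphisms $x_d\colon m_d\to m'_d$ in $M_d$ with $x_e\circ u_{d,e}^\theta=u'^{\,\theta}_{d,e}\circ F_{d,e}^\theta(x_d)$ for all $\theta\colon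 d\to e$. $\mathrm{holim}_{d\in\mathcal{D}}M$ is the full subcategory of $\mathrm{laxholim}_{d\in\mathcal{D}}M$ on the objects for which every $u_{d,e}^\theta$ is a weak equivalence in $M_e$. *)

theory Defs
  imports "HOL-Analysis.Analysis" "HOL-Algebra.Module" "HOL-Algebra.Ideal" "HOL-Algebra.Free_Abelian_Groups" "HOL-Library.Equipollence"
begin

section \<open>Categories\<close>

text \<open>Hom-sets need not be disjoint, so composition takes the three objects involved:
  \<open>Cmp C x y z g f\<close> is \<open>g \<circ> f\<close> for \<open>f : x \<rightarrow> y\<close> and \<open>g : y \<rightarrow> z\<close>.\<close>

record ('o, 'a) cat =
  Obj :: "'o set"
  Mor :: "'o \<Rightarrow> 'o \<Rightarrow> 'a set"
  Ide :: "'o \<Rightarrow> 'a"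
  Cmp :: "'o \<Rightarrow> 'o \<Rightarrow> 'o \<Rightarrow> 'a \<Rightarrow> 'a \<Rightarrow> 'a"

definition category :: "('o, 'a, 'z) cat_scheme \<Rightarrow> bool" where
  "category C \<longleftrightarrow>
     (\<forall>x\<in>Obj C. Ide C x \<in> Mor C x x) \<and>
     (\<forall>x\<in>Obj C. \<forall>y\<in>Obj C. \<forall>z\<in>Obj C. \<forall>f\<in>Mor C x y. \<forall>g\<in>Mor C y z.
        Cmp C x y z g f \<in> Mor C x z) \<and>
     (\<forall>x\<in>Obj C. \<forall>y\<in>Obj C. \<forall>f\<in>Mor C x y.
        Cmp C x x y f (Ide C x) = f \<and> Cmp C x y y (Ide C y) f = f) \<and>
     (\<forall>w\<in>Obj C. \<forall>x\<in>Obj C. \<forall>y\<in>Obj C. \<forall>z\<in>Obj C.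
        \<forall>f\<in>Mor C w x. \<forall>g\<in>Mor C x y. \<forall>h\<in>Mor C y z.
        Cmp C w y z h (Cmp C w x y g f) = Cmp C w x z (Cmp C x y z h g) f)"

definition full_subcategory :: "('o, 'a) cat \<Rightarrow> ('o \<Rightarrow> bool) \<Rightarrow> ('o, 'a) cat" where
  "full_subcategory C P = C\<lparr>Obj := {x \<in> Obj C. P x}\<rparr>"

definition opcat :: "('o, 'a, 'z) cat_scheme \<Rightarrow> ('o, 'a) cat" where
  "opcat C = \<lparr>Obj = Obj C, Mor = (\<lambda>x y. Mor C y x), Ide = Ide C,
              Cmp = (\<lambda>x y z g f. Cmp C z y x f g)\<rparr>"

definition is_iso :: "('o, 'a, 'z) cat_scheme \<Rightarrow> 'o \<Rightarrow> 'o \<Rightarrow> 'a \<Rightarrow> bool" where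
  "is_iso C x y f \<longleftrightarrow> f \<in> Mor C x y \<and>
     (\<exists>g\<in>Mor C y x. Cmp C x y x g f = Ide C x \<and> Cmp C y x y f g = Ide C y)"

text \<open>A functor consists of an object part \<open>Fo\<close> and an arrow part \<open>Fa\<close>; the latter also takes
  source and target.\<close>

definition is_functor ::
  "('o, 'a, 'z) cat_scheme \<Rightarrow> ('p, 'b, 'w) cat_scheme \<Rightarrow>
   ('o \<Rightarrow> 'p) \<Rightarrow> ('o \<Rightarrow> 'o \<Rightarrow> 'a \<Rightarrow> 'b) \<Rightarrow> bool" where
  "is_functor C D Fo Fa \<longleftrightarrow>
     (\<forall>x\<in>Obj C. Fo x \<in> Obj D) \<and>
     (\<forall>x\<in>Obj C. \<forall>y\<in>Obj C. \<forall>f\<in>Mor C x y. Fa x y f \<in> Mor D (Fo x) (Fo y)) \<and>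
     (\<forall>x\<in>Obj C. Fa x x (Ide C x) = Ide D (Fo x)) \<and>
     (\<forall>x\<in>Obj C. \<forall>y\<in>Obj C. \<forall>z\<in>Obj C. \<forall>f\<in>Mor C x y. \<forall>g\<in>Mor C y z.
        Fa x z (Cmp C x y z g f) = Cmp D (Fo x) (Fo y) (Fo z) (Fa y z g) (Fa x y f))"

definition naturally_isomorphic ::
  "('o, 'a, 'z) cat_scheme \<Rightarrow> ('p, 'b, 'w) cat_scheme \<Rightarrow>
   ('o \<Rightarrow> 'p) \<Rightarrow> ('o \<Rightarrow> 'o \<Rightarrow> 'a \<Rightarrow> 'b) \<Rightarrow>
   ('o \<Rightarrow> 'p) \<Rightarrow> ('o \<Rightarrow> 'o \<Rightarrow> 'a \<Rightarrow> 'b) \<Rightarrow> bool" where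
  "naturally_isomorphic C D Fo Fa Go Ga \<longleftrightarrow>
     (\<exists>\<eta>. (\<forall>x\<in>Obj C. is_iso D (Fo x) (Go x) (\<eta> x)) \<and>
          (\<forall>x\<in>Obj C. \<forall>y\<in>Obj C. \<forall>f\<in>Mor C x y.
             Cmp D (Fo x) (Fo y) (Go y) (\<eta> y) (Fa x y f) =
             Cmp D (Fo x) (Go x) (Go y) (Ga x y f) (\<eta> x)))"

definition equivalent_categories ::
  "('o, 'a, 'z) cat_scheme \<Rightarrow> ('p, 'b, 'w) cat_scheme \<Rightarrow> bool" where
  "equivalent_categories C D \<longleftrightarrow> category C \<and> category D \<and>
     (\<exists>Fo Fa Go Ga. is_functor C D Fo Fa \<and> is_functor D C Go Ga \<and>
        naturally_isomorphic C C
          (\<lambda>x. Go (Fo x)) (\<lambda>x y f. Ga (Fo x) (Fo y) (Fa x y f)) (\<lambda>x. x) (\<lambda>x y f. f) \<and>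
        naturally_isomorphic D D
          (\<lambda>x. Fo (Go x)) (\<lambda>x y f. Fa (Go x) (Go y) (Ga x y f)) (\<lambda>x. x) (\<lambda>x y f. f))"

definition is_left_adjoint ::
  "('o, 'a, 'z) cat_scheme \<Rightarrow> ('p, 'b, 'w) cat_scheme \<Rightarrow>
   ('o \<Rightarrow> 'p) \<Rightarrow> ('o \<Rightarrow> 'o \<Rightarrow> 'a \<Rightarrow> 'b) \<Rightarrow> bool" where
  "is_left_adjoint C D Fo Fa \<longleftrightarrow>
     (\<exists>Go Ga \<Phi>. is_functor D C Go Ga \<and>
        (\<forall>x\<in>Obj C. \<forall>y\<in>Obj D. bij_betw (\<Phi> x y) (Mor D (Fo x) y) (Mor C x (Go y))) \<and>
        (\<forall>x\<in>Obj C. \<forall>x'\<in>Obj C. \<forall>y\<in>Obj D. \<forall>f\<in>Mor C x' x. \<forall>h\<in>Mor D (Fo x) y.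
           \<Phi> x' y (Cmp D (Fo x') (Fo x) y h (Fa x' x f)) = Cmp C x' x (Go y) (\<Phi> x y h) f) \<and>
        (\<forall>x\<in>Obj C. \<forall>y\<in>Obj D. \<forall>y'\<in>Obj D. \<forall>g\<in>Mor D y y'. \<forall>h\<in>Mor D (Fo x) y.
           \<Phi> x y' (Cmp D (Fo x) y y' g h) = Cmp C x (Go y) (Go y') (Ga y y' g) (\<Phi> x y h)))"


subsection \<open>Limits and colimits\<close>

definition is_cocone ::
  "('d, 't, 'z) cat_scheme \<Rightarrow> ('o, 'a, 'w) cat_scheme \<Rightarrow>
   ('d \<Rightarrow> 'o) \<Rightarrow> ('d \<Rightarrow> 'd \<Rightarrow> 't \<Rightarrow> 'a) \<Rightarrow> 'o \<Rightarrow> ('d \<Rightarrow> 'a) \<Rightarrow> bool" where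
  "is_cocone J C Fo Fa L \<iota> \<longleftrightarrow> L \<in> Obj C \<and>
     (\<forall>d\<in>Obj J. \<iota> d \<in> Mor C (Fo d) L) \<and>
     (\<forall>d\<in>Obj J. \<forall>e\<in>Obj J. \<forall>t\<in>Mor J d e. Cmp C (Fo d) (Fo e) L (\<iota> e) (Fa d e t) = \<iota> d)"

definition is_colimit ::
  "('d, 't, 'z) cat_scheme \<Rightarrow> ('o, 'a, 'w) cat_scheme \<Rightarrow>
   ('d \<Rightarrow> 'o) \<Rightarrow> ('d \<Rightarrow> 'd \<Rightarrow> 't \<Rightarrow> 'a) \<Rightarrow> 'o \<Rightarrow> ('d \<Rightarrow> 'a) \<Rightarrow> bool" where
  "is_colimit J C Fo Fa L \<iota> \<longleftrightarrow> is_cocone J C Fo Fa L \<iota> \<and>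
     (\<forall>L' \<iota>'. is_cocone J C Fo Fa L' \<iota>' \<longrightarrow>
        (\<exists>!h. h \<in> Mor C L L' \<and> (\<forall>d\<in>Obj J. Cmp C (Fo d) L L' h (\<iota> d) = \<iota>' d)))"

text \<open>The type \<open>'k\<close> fixes what \<open>small\<close> means: a set is small if it injects into \<open>'k\<close>.  In
  particular every small category has a copy of type \<open>('k, 'k) cat\<close>.\<close>

definition cocomplete :: "'k itself \<Rightarrow> ('o, 'a, 'z) cat_scheme \<Rightarrow> bool" where
  "cocomplete K C \<longleftrightarrow>
     (\<forall>(J :: ('k, 'k) cat) Fo Fa. category J \<and> is_functor J C Fo Fa \<longrightarrow>
        (\<exists>L \<iota>. is_colimit J C Fo Fa L \<iota>))"

definition complete_category :: "'k itself \<Rightarrow> ('o, 'a, 'z) cat_scheme \<Rightarrow> bool" where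
  "complete_category K C \<longleftrightarrow> cocomplete K (opcat C)"

definition is_pushout ::
  "('o, 'a, 'z) cat_scheme \<Rightarrow> 'o \<Rightarrow> 'o \<Rightarrow> 'o \<Rightarrow> 'o \<Rightarrow> 'a \<Rightarrow> 'a \<Rightarrow> 'a \<Rightarrow> 'a \<Rightarrow> bool" where
  "is_pushout C a b x y i u v f \<longleftrightarrow>
     a \<in> Obj C \<and> b \<in> Obj C \<and> x \<in> Obj C \<and> y \<in> Obj C \<and>
     i \<in> Mor C a b \<and> u \<in> Mor C a x \<and> v \<in> Mor C b y \<and> f \<in> Mor C x y \<and>
     Cmp C a x y f u = Cmp C a b y v i \<and>
     (\<forall>z\<in>Obj C. \<forall>g\<in>Mor C x z. \<forall>h\<in>Mor C b z. Cmp C a x z g u = Cmp C a b z h i \<longrightarrow>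
        (\<exists>!k. k \<in> Mor C y z \<and> Cmp C x y z k f = g \<and> Cmp C b y z k v = h))"


subsection \<open>Transfinite sequences, relative cell complexes, smallness\<close>

text \<open>Ordinals are represented by well-orders on subsets of the size type \<open>'k\<close>.\<close>

definition order_cat :: "'k rel \<Rightarrow> ('k, unit) cat" where
  "order_cat r = \<lparr>Obj = Field r, Mor = (\<lambda>i j. if (i, j) \<in> r then {()} else {}),
                  Ide = (\<lambda>i. ()), Cmp = (\<lambda>i j k g f. ())\<rparr>"

definition succ_in :: "'k rel \<Rightarrow> 'k \<Rightarrow> 'k \<Rightarrow> bool" where
  "succ_in r i j \<longleftrightarrow> (i, j) \<in> r \<and> i \<noteq> j \<and> (\<forall>k. (i, k) \<in> r \<and> (k, j) \<in> r \<longrightarrow> k = i \<or> k = j)"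

definition limit_in :: "'k rel \<Rightarrow> 'k \<Rightarrow> bool" where
  "limit_in r l \<longleftrightarrow> l \<in> Field r \<and> underS r l \<noteq> {} \<and> \<not> (\<exists>i. succ_in r i l)"

definition transfinite_sequence ::
  "'k rel \<Rightarrow> ('o, 'a, 'z) cat_scheme \<Rightarrow> ('k \<Rightarrow> 'o) \<Rightarrow> ('k \<Rightarrow> 'k \<Rightarrow> unit \<Rightarrow> 'a) \<Rightarrow> bool" where
  "transfinite_sequence r C Fo Fa \<longleftrightarrow> Well_order r \<and> Field r \<noteq> {} \<and>
     is_functor (order_cat r) C Fo Fa \<and>
     (\<forall>l. limit_in r l \<longrightarrow>
        is_colimit (order_cat (Restr r (underS r l))) C Fo Fa (Fo l) (\<lambda>i. Fa i l ()))"

definition pushouts_of ::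
  "('o, 'a, 'z) cat_scheme \<Rightarrow> ('o \<times> 'o \<times> 'a) set \<Rightarrow> 'o \<Rightarrow> 'o \<Rightarrow> 'a set" where
  "pushouts_of C I x y = {f. \<exists>a b i u v. (a, b, i) \<in> I \<and> is_pushout C a b x y i u v f}"

definition relative_cells ::
  "'k itself \<Rightarrow> ('o, 'a, 'z) cat_scheme \<Rightarrow> ('o \<times> 'o \<times> 'a) set \<Rightarrow> 'o \<Rightarrow> 'o \<Rightarrow> 'a set" where
  "relative_cells K C I x y =
     {f. \<exists>(r :: 'k rel) Fo Fa i0 \<iota>. transfinite_sequence r C Fo Fa \<and>
          i0 \<in> Field r \<and> (\<forall>j\<in>Field r. (i0, j) \<in> r) \<and>
          (\<forall>i j. succ_in r i j \<longrightarrow> Fa i j () \<in> pushouts_of C I (Fo i) (Fo j)) \<and>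
          Fo i0 = x \<and> is_colimit (order_cat r) C Fo Fa y \<iota> \<and> f = \<iota> i0}"

text \<open>\<open>A\<close> is small relative to the class of arrows \<open>D\<close>: for some cardinal \<open>\<kappa>\<close>, the functor
  \<open>Hom(A, -)\<close> preserves the colimits of all \<open>\<lambda>\<close>-sequences of arrows in \<open>D\<close> with \<open>\<lambda> \<ge> \<kappa>\<close> regular.
  The last two conjuncts say that the map \<open>colim Hom(A, F\<^sub>i) \<rightarrow> Hom(A, colim F\<^sub>i)\<close> is surjective
  and injective.\<close>

definition small_relative ::
  "'k itself \<Rightarrow> ('o, 'a, 'z) cat_scheme \<Rightarrow> ('o \<Rightarrow> 'o \<Rightarrow> 'a set) \<Rightarrow> 'o \<Rightarrow> bool" where
  "small_relative K C D A \<longleftrightarrow>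
     (\<exists>\<kappa> :: 'k rel. Card_order \<kappa> \<and> infinite (Field \<kappa>) \<and> regularCard \<kappa> \<and>
        (\<forall>(r :: 'k rel) Fo Fa L \<iota>.
           Card_order r \<and> infinite (Field r) \<and> regularCard r \<and> (\<kappa>, r) \<in> ordLeq \<and>
           transfinite_sequence r C Fo Fa \<and>
           (\<forall>i j. succ_in r i j \<longrightarrow> Fa i j () \<in> D (Fo i) (Fo j)) \<and>
           is_colimit (order_cat r) C Fo Fa L \<iota> \<longrightarrow>
             (\<forall>g\<in>Mor C A L. \<exists>i\<in>Field r. \<exists>h\<in>Mor C A (Fo i). Cmp C A (Fo i) L (\<iota> i) h = g) \<and>
             (\<forall>i\<in>Field r. \<forall>h\<in>Mor C A (Fo i). \<forall>h'\<in>Mor C A (Fo i).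
                Cmp C A (Fo i) L (\<iota> i) h = Cmp C A (Fo i) L (\<iota> i) h' \<longrightarrow>
                (\<exists>j. (i, j) \<in> r \<and>
                   Cmp C A (Fo i) (Fo j) (Fa i j ()) h = Cmp C A (Fo i) (Fo j) (Fa i j ()) h'))))"


section \<open>Model categories\<close>

record ('o, 'a) model_cat = "('o, 'a) cat" +
  Weq :: "'o \<Rightarrow> 'o \<Rightarrow> 'a set"
  Cof :: "'o \<Rightarrow> 'o \<Rightarrow> 'a set"
  Fib :: "'o \<Rightarrow> 'o \<Rightarrow> 'a set"

definition with_model_structure ::
  "('o, 'a) cat \<Rightarrow> ('o \<Rightarrow> 'o \<Rightarrow> 'a set) \<Rightarrow> ('o \<Rightarrow> 'o \<Rightarrow> 'a set) \<Rightarrow> ('o \<Rightarrow> 'o \<Rightarrow> 'a set) \<Rightarrow>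
   ('o, 'a) model_cat" where
  "with_model_structure C W Co Fi =
     \<lparr>Obj = Obj C, Mor = Mor C, Ide = Ide C, Cmp = Cmp C, Weq = W, Cof = Co, Fib = Fi\<rparr>"

definition is_retract ::
  "('o, 'a, 'z) cat_scheme \<Rightarrow> 'o \<Rightarrow> 'o \<Rightarrow> 'a \<Rightarrow> 'o \<Rightarrow> 'o \<Rightarrow> 'a \<Rightarrow> bool" where
  "is_retract C x y f x' y' f' \<longleftrightarrow>
     (\<exists>i\<in>Mor C x x'. \<exists>r\<in>Mor C x' x. \<exists>j\<in>Mor C y y'. \<exists>q\<in>Mor C y' y.
        Cmp C x x' x r i = Ide C x \<and> Cmp C y y' y q j = Ide C y \<and>
        Cmp C x x' y' f' i = Cmp C x y y' j f \<and> Cmp C x' x y f r = Cmp C x' y' y q f')"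

definition has_lifting ::
  "('o, 'a, 'z) cat_scheme \<Rightarrow> 'o \<Rightarrow> 'o \<Rightarrow> 'a \<Rightarrow> 'o \<Rightarrow> 'o \<Rightarrow> 'a \<Rightarrow> bool" where
  "has_lifting C a b i x y p \<longleftrightarrow>
     (\<forall>u\<in>Mor C a x. \<forall>v\<in>Mor C b y. Cmp C a x y p u = Cmp C a b y v i \<longrightarrow>
        (\<exists>h\<in>Mor C b x. Cmp C a b x h i = u \<and> Cmp C b x y p h = v))"

text \<open>A subcategory containing all objects and closed under retracts.\<close>

definition retract_closed_subcategory ::
  "('o, 'a, 'z) cat_scheme \<Rightarrow> ('o \<Rightarrow> 'o \<Rightarrow> 'a set) \<Rightarrow> bool" where
  "retract_closed_subcategory C S \<longleftrightarrow>
     (\<forall>x\<in>Obj C. \<forall>y\<in>Obj C. S x y \<subseteq> Mor C x y) \<and>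
     (\<forall>x\<in>Obj C. Ide C x \<in> S x x) \<and>
     (\<forall>x\<in>Obj C. \<forall>y\<in>Obj C. \<forall>z\<in>Obj C. \<forall>f\<in>S x y. \<forall>g\<in>S y z. Cmp C x y z g f \<in> S x z) \<and>
     (\<forall>x\<in>Obj C. \<forall>y\<in>Obj C. \<forall>x'\<in>Obj C. \<forall>y'\<in>Obj C. \<forall>f\<in>Mor C x y. \<forall>f'\<in>S x' y'.
        is_retract C x y f x' y' f' \<longrightarrow> f \<in> S x y)"

definition model_category :: "'k itself \<Rightarrow> ('o, 'a) model_cat \<Rightarrow> bool" where
  "model_category K M \<longleftrightarrow>
     category M \<and> complete_category K M \<and> cocomplete K M \<and>
     retract_closed_subcategory M (Weq M) \<and>
     retract_closed_subcategory M (Cof M) \<and>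
     retract_closed_subcategory M (Fib M) \<and>
     (\<forall>x\<in>Obj M. \<forall>y\<in>Obj M. \<forall>z\<in>Obj M. \<forall>f\<in>Mor M x y. \<forall>g\<in>Mor M y z.
        (f \<in> Weq M x y \<and> Cmp M x y z g f \<in> Weq M x z \<longrightarrow> g \<in> Weq M y z) \<and>
        (g \<in> Weq M y z \<and> Cmp M x y z g f \<in> Weq M x z \<longrightarrow> f \<in> Weq M x y)) \<and>
     (\<forall>a\<in>Obj M. \<forall>b\<in>Obj M. \<forall>x\<in>Obj M. \<forall>y\<in>Obj M. \<forall>i\<in>Cof M a b. \<forall>p\<in>Fib M x y.
        i \<in> Weq M a b \<or> p \<in> Weq M x y \<longrightarrow> has_lifting M a b i x y p) \<and>
     (\<forall>x\<in>Obj M. \<forall>y\<in>Obj M. \<forall>f\<in>Mor M x y.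
        (\<exists>z\<in>Obj M. \<exists>i\<in>Cof M x z \<inter> Weq M x z. \<exists>p\<in>Fib M z y. Cmp M x z y p i = f) \<and>
        (\<exists>z\<in>Obj M. \<exists>i\<in>Cof M x z. \<exists>p\<in>Fib M z y \<inter> Weq M z y. Cmp M x z y p i = f))"

definition injectives ::
  "('o, 'a, 'z) cat_scheme \<Rightarrow> ('o \<times> 'o \<times> 'a) set \<Rightarrow> 'o \<Rightarrow> 'o \<Rightarrow> 'a set" where
  "injectives C I x y = {p \<in> Mor C x y. \<forall>(a, b, i)\<in>I. has_lifting C a b i x y p}"

definition cofibrantly_generated :: "'k itself \<Rightarrow> ('o, 'a) model_cat \<Rightarrow> bool" where
  "cofibrantly_generated K M \<longleftrightarrow>
     (\<exists>I J. (\<forall>(a, b, i)\<in>I \<union> J. a \<in> Obj M \<and> b \<in> Obj M \<and> i \<in> Mor M a b) \<and>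
        I \<lesssim> (UNIV :: 'k set) \<and> J \<lesssim> (UNIV :: 'k set) \<and>
        (\<forall>(a, b, i)\<in>I. small_relative K M (relative_cells K M I) a) \<and>
        (\<forall>(a, b, i)\<in>J. small_relative K M (relative_cells K M J) a) \<and>
        (\<forall>x\<in>Obj M. \<forall>y\<in>Obj M.
           Fib M x y = injectives M J x y \<and> Fib M x y \<inter> Weq M x y = injectives M I x y))"

definition left_quillen ::
  "('o, 'a) model_cat \<Rightarrow> ('p, 'b) model_cat \<Rightarrow>
   ('o \<Rightarrow> 'p) \<Rightarrow> ('o \<Rightarrow> 'o \<Rightarrow> 'a \<Rightarrow> 'b) \<Rightarrow> bool" where
  "left_quillen M N Fo Fa \<longleftrightarrow> is_functor M N Fo Fa \<and> is_left_adjoint M N Fo Fa \<and>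
     (\<forall>x\<in>Obj M. \<forall>y\<in>Obj M. \<forall>f\<in>Cof M x y. Fa x y f \<in> Cof N (Fo x) (Fo y)) \<and>
     (\<forall>x\<in>Obj M. \<forall>y\<in>Obj M. \<forall>f\<in>Cof M x y \<inter> Weq M x y.
        Fa x y f \<in> Cof N (Fo x) (Fo y) \<inter> Weq N (Fo x) (Fo y))"


subsection \<open>Lax and strict homotopy limits\<close>

text \<open>Functors such as pullbacks compose only up to canonical isomorphism, so a diagram of model
  categories carries these isomorphisms as data:
  \<open>fcmp d e f \<eta> \<theta> m : F\<^sup>\<eta>\<^sup>\<theta> m \<rightarrow> F\<^sup>\<eta> (F\<^sup>\<theta> m)\<close> for \<open>\<theta> : d \<rightarrow> e\<close> and \<open>\<eta> : e \<rightarrow> f\<close>, and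
  \<open>funit d m : F\<^sup>i\<^sup>d m \<rightarrow> m\<close>.  For a strict diagram all of them are identities.  The record
  is bare data; \<open>laxholim\<close> inserts the isomorphisms in its functoriality conditions.\<close>

record ('d, 't, 'o, 'a) model_diagram =
  shape :: "('d, 't) cat"
  mcat :: "'d \<Rightarrow> ('o, 'a) model_cat"
  fobj :: "'d \<Rightarrow> 'd \<Rightarrow> 't \<Rightarrow> 'o \<Rightarrow> 'o"
  fmor :: "'d \<Rightarrow> 'd \<Rightarrow> 't \<Rightarrow> 'o \<Rightarrow> 'o \<Rightarrow> 'a \<Rightarrow> 'a"
  fcmp :: "'d \<Rightarrow> 'd \<Rightarrow> 'd \<Rightarrow> 't \<Rightarrow> 't \<Rightarrow> 'o \<Rightarrow> 'a"
  funit :: "'d \<Rightarrow> 'o \<Rightarrow> 'a"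

definition laxholim_objects ::
  "('d, 't, 'o, 'a) model_diagram \<Rightarrow> (('d \<Rightarrow> 'o) \<times> ('d \<Rightarrow> 'd \<Rightarrow> 't \<Rightarrow> 'a)) set" where
  "laxholim_objects M =
     {(m, u). (let D = shape M in
        m \<in> (\<Pi>\<^sub>E d\<in>Obj D. Obj (mcat M d)) \<and>
        (\<forall>d e \<theta>. \<not> (d \<in> Obj D \<and> e \<in> Obj D \<and> \<theta> \<in> Mor D d e) \<longrightarrow> u d e \<theta> = undefined) \<and>
        (\<forall>d\<in>Obj D. \<forall>e\<in>Obj D. \<forall>\<theta>\<in>Mor D d e.
           u d e \<theta> \<in> Mor (mcat M e) (fobj M d e \<theta> (m d)) (m e)) \<and>
        (\<forall>d\<in>Obj D. \<forall>e\<in>Obj D. \<forall>f\<in>Obj D. \<forall>\<theta>\<in>Mor D d e. \<forall>\<eta>\<in>Mor D e f.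
           (let \<eta>\<theta> = Cmp D d e f \<eta> \<theta>; F\<theta> = fobj M d e \<theta> (m d); F\<eta>F\<theta> = fobj M e f \<eta> F\<theta> in
            u d f \<eta>\<theta> =
              Cmp (mcat M f) (fobj M d f \<eta>\<theta> (m d)) F\<eta>F\<theta> (m f)
                (Cmp (mcat M f) F\<eta>F\<theta> (fobj M e f \<eta> (m e)) (m f)
                   (u e f \<eta>) (fmor M e f \<eta> F\<theta> (m e) (u d e \<theta>)))
                (fcmp M d e f \<eta> \<theta> (m d)))) \<and>
        (\<forall>d\<in>Obj D. u d d (Ide D d) = funit M d (m d)))}"

definition laxholim ::
  "('d, 't, 'o, 'a) model_diagram \<Rightarrow>
   (('d \<Rightarrow> 'o) \<times> ('d \<Rightarrow> 'd \<Rightarrow> 't \<Rightarrow> 'a), 'd \<Rightarrow> 'a) cat" where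
  "laxholim M = (let D = shape M in
     \<lparr>Obj = laxholim_objects M,
      Mor = (\<lambda>(m, u) (m', u').
        {x \<in> (\<Pi>\<^sub>E d\<in>Obj D. Mor (mcat M d) (m d) (m' d)).
           \<forall>d\<in>Obj D. \<forall>e\<in>Obj D. \<forall>\<theta>\<in>Mor D d e.
             Cmp (mcat M e) (fobj M d e \<theta> (m d)) (m e) (m' e) (x e) (u d e \<theta>) =
             Cmp (mcat M e) (fobj M d e \<theta> (m d)) (fobj M d e \<theta> (m' d)) (m' e)
               (u' d e \<theta>) (fmor M d e \<theta> (m d) (m' d) (x d))}),
      Ide = (\<lambda>(m, u). \<lambda>d\<in>Obj D. Ide (mcat M d) (m d)),
      Cmp = (\<lambda>(m, u) (m', u') (m'', u'') y x.
               \<lambda>d\<in>Obj D. Cmp (mcat M d) (m d) (m' d) (m'' d) (y d) (x d))\<rparr>)"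

definition holim ::
  "('d, 't, 'o, 'a) model_diagram \<Rightarrow>
   (('d \<Rightarrow> 'o) \<times> ('d \<Rightarrow> 'd \<Rightarrow> 't \<Rightarrow> 'a), 'd \<Rightarrow> 'a) cat" where
  "holim M = full_subcategory (laxholim M)
     (\<lambda>(m, u). \<forall>d\<in>Obj (shape M). \<forall>e\<in>Obj (shape M). \<forall>\<theta>\<in>Mor (shape M) d e.
        u d e \<theta> \<in> Weq (mcat M e) (fobj M d e \<theta> (m d)) (m e))"

text \<open>The simplex category; \<open>[p] = {0, \<dots>, p}\<close> is represented by \<open>p\<close>.\<close>

definition Simplex :: "(nat, nat \<Rightarrow> nat) cat" where
  "Simplex = \<lparr>Obj = UNIV,
     Mor = (\<lambda>p q. {\<alpha> \<in> {..p} \<rightarrow>\<^sub>E {..q}. mono_on {..p} \<alpha>}),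
     Ide = (\<lambda>p. \<lambda>i\<in>{..p}. i),
     Cmp = (\<lambda>p q r \<beta> \<alpha>. compose {..p} \<beta> \<alpha>)\<rparr>"


section \<open>Sheaves\<close>

text \<open>A presheaf of sets on \<open>Y\<close> is given by \<open>S\<close>, the sets of sections, and \<open>\<rho>\<close>, where
  \<open>\<rho> U V\<close> restricts from \<open>U\<close> to \<open>V \<subseteq> U\<close>.  Values on non-open sets are irrelevant throughout.\<close>

definition is_presheaf ::
  "'y topology \<Rightarrow> ('y set \<Rightarrow> 'e set) \<Rightarrow> ('y set \<Rightarrow> 'y set \<Rightarrow> 'e \<Rightarrow> 'e) \<Rightarrow> bool" where
  "is_presheaf Y S \<rho> \<longleftrightarrow>
     (\<forall>U V. openin Y U \<and> openin Y V \<and> V \<subseteq> U \<longrightarrow> \<rho> U V \<in> S U \<rightarrow> S V) \<and>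
     (\<forall>U. openin Y U \<longrightarrow> (\<forall>s\<in>S U. \<rho> U U s = s)) \<and>
     (\<forall>U V W. openin Y U \<and> openin Y V \<and> openin Y W \<and> V \<subseteq> U \<and> W \<subseteq> V \<longrightarrow>
        (\<forall>s\<in>S U. \<rho> V W (\<rho> U V s) = \<rho> U W s))"

definition is_sheaf ::
  "'y topology \<Rightarrow> ('y set \<Rightarrow> 'e set) \<Rightarrow> ('y set \<Rightarrow> 'y set \<Rightarrow> 'e \<Rightarrow> 'e) \<Rightarrow> bool" where
  "is_sheaf Y S \<rho> \<longleftrightarrow> is_presheaf Y S \<rho> \<and>
     (\<forall>\<V> t. (\<forall>V\<in>\<V>. openin Y V \<and> t V \<in> S V) \<and>
            (\<forall>V\<in>\<V>. \<forall>W\<in>\<V>. \<rho> V (V \<inter> W) (t V) = \<rho> W (V \<inter> W) (t W)) \<longrightarrow>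
        (\<exists>!s. s \<in> S (\<Union>\<V>) \<and> (\<forall>V\<in>\<V>. \<rho> (\<Union>\<V>) V s = t V)))"

definition germ ::
  "'y topology \<Rightarrow> ('y set \<Rightarrow> 'e set) \<Rightarrow> ('y set \<Rightarrow> 'y set \<Rightarrow> 'e \<Rightarrow> 'e) \<Rightarrow>
   'y \<Rightarrow> 'y set \<times> 'e \<Rightarrow> ('y set \<times> 'e) set" where
  "germ Y S \<rho> y = (\<lambda>(U, s).
     {(V, t). openin Y V \<and> y \<in> V \<and> t \<in> S V \<and>
        (\<exists>W. openin Y W \<and> y \<in> W \<and> W \<subseteq> U \<inter> V \<and> \<rho> U W s = \<rho> V W t)})"

definition stalk ::
  "'y topology \<Rightarrow> ('y set \<Rightarrow> 'e set) \<Rightarrow> ('y set \<Rightarrow> 'y set \<Rightarrow> 'e \<Rightarrow> 'e) \<Rightarrow>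
   'y \<Rightarrow> ('y set \<times> 'e) set set" where
  "stalk Y S \<rho> y = {germ Y S \<rho> y (U, s) | U s. openin Y U \<and> y \<in> U \<and> s \<in> S U}"

text \<open>Sections of the associated sheaf: families of germs that are locally given by a section.\<close>

definition associated_sections ::
  "'y topology \<Rightarrow> ('y set \<Rightarrow> 'e set) \<Rightarrow> ('y set \<Rightarrow> 'y set \<Rightarrow> 'e \<Rightarrow> 'e) \<Rightarrow>
   'y set \<Rightarrow> ('y \<Rightarrow> ('y set \<times> 'e) set) set" where
  "associated_sections Y S \<rho> V =
     {t \<in> (\<Pi>\<^sub>E y\<in>V. stalk Y S \<rho> y).
        \<forall>y\<in>V. \<exists>U s. openin Y U \<and> y \<in> U \<and> U \<subseteq> V \<and> s \<in> S U \<and> (\<forall>z\<in>U. t z = germ Y S \<rho> z (U, s))}"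


subsection \<open>Locally ringed spaces\<close>

record ('y, 'r) ringed_space =
  spc :: "'y topology"
  osec :: "'y set \<Rightarrow> 'r ring"
  ores :: "'y set \<Rightarrow> 'y set \<Rightarrow> 'r \<Rightarrow> 'r"

definition ringed_space :: "('y, 'r) ringed_space \<Rightarrow> bool" where
  "ringed_space Y \<longleftrightarrow>
     is_sheaf (spc Y) (\<lambda>U. carrier (osec Y U)) (ores Y) \<and>
     (\<forall>U. openin (spc Y) U \<longrightarrow> cring (osec Y U)) \<and>
     (\<forall>U V. openin (spc Y) U \<and> openin (spc Y) V \<and> V \<subseteq> U \<longrightarrow>
        ores Y U V \<in> ring_hom (osec Y U) (osec Y V))"

abbreviation ogerm :: "('y, 'r) ringed_space \<Rightarrow> 'y \<Rightarrow> 'y set \<times> 'r \<Rightarrow> ('y set \<times> 'r) set" where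
  "ogerm Y \<equiv> germ (spc Y) (\<lambda>U. carrier (osec Y U)) (ores Y)"

text \<open>The operations on germs are computed on representatives; the result does not depend on them,
  so the unions below are unions of a single set.\<close>

definition stalk_ring :: "('y, 'r) ringed_space \<Rightarrow> 'y \<Rightarrow> ('y set \<times> 'r) set ring" where
  "stalk_ring Y y =
     \<lparr>carrier = stalk (spc Y) (\<lambda>U. carrier (osec Y U)) (ores Y) y,
      monoid.mult = (\<lambda>A B. \<Union>(U, a)\<in>A. \<Union>(V, b)\<in>B.
        ogerm Y y (U \<inter> V, ores Y U (U \<inter> V) a \<otimes>\<^bsub>osec Y (U \<inter> V)\<^esub> ores Y V (U \<inter> V) b)),
      monoid.one = ogerm Y y (topspace (spc Y), \<one>\<^bsub>osec Y (topspace (spc Y))\<^esub>),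
      ring.zero = ogerm Y y (topspace (spc Y), \<zero>\<^bsub>osec Y (topspace (spc Y))\<^esub>),
      ring.add = (\<lambda>A B. \<Union>(U, a)\<in>A. \<Union>(V, b)\<in>B.
        ogerm Y y (U \<inter> V, ores Y U (U \<inter> V) a \<oplus>\<^bsub>osec Y (U \<inter> V)\<^esub> ores Y V (U \<inter> V) b))\<rparr>"

definition locally_ringed_space :: "('y, 'r) ringed_space \<Rightarrow> bool" where
  "locally_ringed_space Y \<longleftrightarrow> ringed_space Y \<and>
     (\<forall>y\<in>topspace (spc Y). \<exists>!J. maximalideal J (stalk_ring Y y))"

text \<open>A morphism \<open>Z \<rightarrow> Y\<close> of ringed spaces is a pair of a map \<open>f\<close> on points and maps
  \<open>\<O>\<^sub>Y(U) \<rightarrow> \<O>\<^sub>Z(f\<^sup>-\<^sup>1 U)\<close>.\<close>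

type_synonym ('z, 'y, 'a, 'b) rs_map = "('z \<Rightarrow> 'y) \<times> ('y set \<Rightarrow> 'a \<Rightarrow> 'b)"

definition preim :: "('z, 'b) ringed_space \<Rightarrow> ('z, 'y, 'a, 'b) rs_map \<Rightarrow> 'y set \<Rightarrow> 'z set" where
  "preim Z \<phi> U = {z \<in> topspace (spc Z). fst \<phi> z \<in> U}"

definition stalk_map ::
  "('z, 'b) ringed_space \<Rightarrow> ('y, 'a) ringed_space \<Rightarrow> ('z, 'y, 'a, 'b) rs_map \<Rightarrow>
   'z \<Rightarrow> ('y set \<times> 'a) set \<Rightarrow> ('z set \<times> 'b) set" where
  "stalk_map Z Y \<phi> z A = (\<Union>(U, a)\<in>A. ogerm Z z (preim Z \<phi> U, snd \<phi> U a))"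

text \<open>The space \<open>Y\<close> with structure sheaf \<open>f\<^sup>-\<^sup>1 \<O>\<^sub>X\<close> for \<open>f : Y \<rightarrow> X\<close>: sections over \<open>V\<close> are families
  of germs in \<open>\<O>\<^sub>X\<^sub>,\<^sub>f\<^sub>(\<^sub>y\<^sub>)\<close>, \<open>y \<in> V\<close>, that are locally given by a section of \<open>\<O>\<^sub>X\<close>.\<close>

definition inverse_image_space ::
  "('y \<Rightarrow> 'x) \<Rightarrow> 'y topology \<Rightarrow> ('x, 'r) ringed_space \<Rightarrow>
   ('y, 'y \<Rightarrow> ('x set \<times> 'r) set) ringed_space" where
  "inverse_image_space f Y X =
     \<lparr>spc = Y,
      osec = (\<lambda>V.
        \<lparr>carrier = {t \<in> (\<Pi>\<^sub>E y\<in>V. carrier (stalk_ring X (f y))).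
           \<forall>y\<in>V. \<exists>W U s. openin Y W \<and> y \<in> W \<and> W \<subseteq> V \<and> openin (spc X) U \<and> f ` W \<subseteq> U \<and>
             s \<in> carrier (osec X U) \<and> (\<forall>w\<in>W. t w = ogerm X (f w) (U, s))},
         monoid.mult = (\<lambda>s t. \<lambda>y\<in>V. s y \<otimes>\<^bsub>stalk_ring X (f y)\<^esub> t y),
         monoid.one = (\<lambda>y\<in>V. \<one>\<^bsub>stalk_ring X (f y)\<^esub>),
         ring.zero = (\<lambda>y\<in>V. \<zero>\<^bsub>stalk_ring X (f y)\<^esub>),
         ring.add = (\<lambda>s t. \<lambda>y\<in>V. s y \<oplus>\<^bsub>stalk_ring X (f y)\<^esub> t y)\<rparr>),
      ores = (\<lambda>V W t. restrict t W)\<rparr>"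


subsection \<open>Sheaves of modules\<close>

text \<open>The fields \<open>mult\<close> and \<open>one\<close> that the library record for modules inherits from rings play no
  role for modules.\<close>

record ('y, 'a, 'm) mod_sheaf =
  msec :: "'y set \<Rightarrow> ('a, 'm) module"
  mres :: "'y set \<Rightarrow> 'y set \<Rightarrow> 'm \<Rightarrow> 'm"

definition is_mod_sheaf :: "('y, 'a) ringed_space \<Rightarrow> ('y, 'a, 'm) mod_sheaf \<Rightarrow> bool" where
  "is_mod_sheaf Y F \<longleftrightarrow>
     is_sheaf (spc Y) (\<lambda>U. carrier (msec F U)) (mres F) \<and>
     (\<forall>U. openin (spc Y) U \<longrightarrow> Module.module (osec Y U) (msec F U)) \<and>
     (\<forall>U V. openin (spc Y) U \<and> openin (spc Y) V \<and> V \<subseteq> U \<longrightarrow>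
        (\<forall>s\<in>carrier (msec F U). \<forall>t\<in>carrier (msec F U).
           mres F U V (s \<oplus>\<^bsub>msec F U\<^esub> t) = mres F U V s \<oplus>\<^bsub>msec F V\<^esub> mres F U V t) \<and>
        (\<forall>a\<in>carrier (osec Y U). \<forall>s\<in>carrier (msec F U).
           mres F U V (a \<odot>\<^bsub>msec F U\<^esub> s) = ores Y U V a \<odot>\<^bsub>msec F V\<^esub> mres F U V s))"

text \<open>The value at non-open sets, and outside the modules of sections, is fixed to \<open>undefined\<close>, so
  that equality of morphisms is equality of functions.\<close>

type_synonym ('y, 'm) mod_sheaf_mor = "'y set \<Rightarrow> 'm \<Rightarrow> 'm"

definition mod_sheaf_hom ::
  "('y, 'a) ringed_space \<Rightarrow> ('y, 'a, 'm) mod_sheaf \<Rightarrow> ('y, 'a, 'm) mod_sheaf \<Rightarrow>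
   ('y, 'm) mod_sheaf_mor set" where
  "mod_sheaf_hom Y F G =
     {\<psi>. (\<forall>U. \<not> openin (spc Y) U \<longrightarrow> \<psi> U = undefined) \<and>
        (\<forall>U. openin (spc Y) U \<longrightarrow>
           \<psi> U \<in> carrier (msec F U) \<rightarrow>\<^sub>E carrier (msec G U) \<and>
           (\<forall>s\<in>carrier (msec F U). \<forall>t\<in>carrier (msec F U).
              \<psi> U (s \<oplus>\<^bsub>msec F U\<^esub> t) = \<psi> U s \<oplus>\<^bsub>msec G U\<^esub> \<psi> U t) \<and>
           (\<forall>a\<in>carrier (osec Y U). \<forall>s\<in>carrier (msec F U).
              \<psi> U (a \<odot>\<^bsub>msec F U\<^esub> s) = a \<odot>\<^bsub>msec G U\<^esub> \<psi> U s)) \<and>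
        (\<forall>U V. openin (spc Y) U \<and> openin (spc Y) V \<and> V \<subseteq> U \<longrightarrow>
           (\<forall>s\<in>carrier (msec F U). \<psi> V (mres F U V s) = mres G U V (\<psi> U s)))}"

definition mod_sheaf_id ::
  "('y, 'a) ringed_space \<Rightarrow> ('y, 'a, 'm) mod_sheaf \<Rightarrow> ('y, 'm) mod_sheaf_mor" where
  "mod_sheaf_id Y F = (\<lambda>U. if openin (spc Y) U then (\<lambda>s\<in>carrier (msec F U). s) else undefined)"

definition mod_sheaf_comp ::
  "('y, 'a) ringed_space \<Rightarrow> ('y, 'a, 'm) mod_sheaf \<Rightarrow>
   ('y, 'm) mod_sheaf_mor \<Rightarrow> ('y, 'm) mod_sheaf_mor \<Rightarrow> ('y, 'm) mod_sheaf_mor" where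
  "mod_sheaf_comp Y F \<xi> \<psi> =
     (\<lambda>U. if openin (spc Y) U then compose (carrier (msec F U)) (\<xi> U) (\<psi> U) else undefined)"

abbreviation mgerm ::
  "('y, 'a) ringed_space \<Rightarrow> ('y, 'a, 'm) mod_sheaf \<Rightarrow> 'y \<Rightarrow> 'y set \<times> 'm \<Rightarrow> ('y set \<times> 'm) set" where
  "mgerm Y F \<equiv> germ (spc Y) (\<lambda>U. carrier (msec F U)) (mres F)"

definition stalk_module ::
  "('y, 'a) ringed_space \<Rightarrow> ('y, 'a, 'm) mod_sheaf \<Rightarrow> 'y \<Rightarrow>
   (('y set \<times> 'a) set, ('y set \<times> 'm) set) module" where
  "stalk_module Y F y =
     \<lparr>carrier = stalk (spc Y) (\<lambda>U. carrier (msec F U)) (mres F) y,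
      monoid.mult = undefined, monoid.one = undefined,
      ring.zero = mgerm Y F y (topspace (spc Y), \<zero>\<^bsub>msec F (topspace (spc Y))\<^esub>),
      ring.add = (\<lambda>A B. \<Union>(U, s)\<in>A. \<Union>(V, t)\<in>B.
        mgerm Y F y (U \<inter> V, mres F U (U \<inter> V) s \<oplus>\<^bsub>msec F (U \<inter> V)\<^esub> mres F V (U \<inter> V) t)),
      module.smult = (\<lambda>A B. \<Union>(U, a)\<in>A. \<Union>(V, s)\<in>B.
        mgerm Y F y (U \<inter> V, ores Y U (U \<inter> V) a \<odot>\<^bsub>msec F (U \<inter> V)\<^esub> mres F V (U \<inter> V) s))\<rparr>"

definition stalk_mor ::
  "('y, 'a) ringed_space \<Rightarrow> ('y, 'a, 'm) mod_sheaf \<Rightarrow> ('y, 'm) mod_sheaf_mor \<Rightarrow>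
   'y \<Rightarrow> ('y set \<times> 'm) set \<Rightarrow> ('y set \<times> 'm) set" where
  "stalk_mor Y G \<psi> y A = (\<Union>(U, s)\<in>A. mgerm Y G y (U, \<psi> U s))"


subsection \<open>Extension of scalars\<close>

text \<open>For a ring homomorphism \<open>h : R \<rightarrow> S\<close> and an \<open>R\<close>-module \<open>M\<close>, the \<open>S\<close>-module \<open>S \<otimes>\<^sub>R M\<close>: the
  free abelian group on \<open>S \<times> M\<close> modulo the bilinearity and balancing relations.\<close>

definition tensor_relations ::
  "'a ring \<Rightarrow> 'b ring \<Rightarrow> ('a \<Rightarrow> 'b) \<Rightarrow> ('a, 'm) module \<Rightarrow> ('b \<times> 'm \<Rightarrow>\<^sub>0 int) set" where
  "tensor_relations R S h M =
     {frag_of (b \<oplus>\<^bsub>S\<^esub> b', m) - frag_of (b, m) - frag_of (b', m) | b b' m.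
        b \<in> carrier S \<and> b' \<in> carrier S \<and> m \<in> carrier M} \<union>
     {frag_of (b, m \<oplus>\<^bsub>M\<^esub> m') - frag_of (b, m) - frag_of (b, m') | b m m'.
        b \<in> carrier S \<and> m \<in> carrier M \<and> m' \<in> carrier M} \<union>
     {frag_of (b \<otimes>\<^bsub>S\<^esub> h r, m) - frag_of (b, r \<odot>\<^bsub>M\<^esub> m) | b r m.
        b \<in> carrier S \<and> r \<in> carrier R \<and> m \<in> carrier M}"

definition tensor_kernel ::
  "'a ring \<Rightarrow> 'b ring \<Rightarrow> ('a \<Rightarrow> 'b) \<Rightarrow> ('a, 'm) module \<Rightarrow> ('b \<times> 'm \<Rightarrow>\<^sub>0 int) set" where
  "tensor_kernel R S h M =
     generate (free_Abelian_group (carrier S \<times> carrier M)) (tensor_relations R S h M)"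

definition tensor_class ::
  "'a ring \<Rightarrow> 'b ring \<Rightarrow> ('a \<Rightarrow> 'b) \<Rightarrow> ('a, 'm) module \<Rightarrow>
   ('b \<times> 'm \<Rightarrow>\<^sub>0 int) \<Rightarrow> ('b \<times> 'm \<Rightarrow>\<^sub>0 int) set" where
  "tensor_class R S h M c =
     tensor_kernel R S h M #>\<^bsub>free_Abelian_group (carrier S \<times> carrier M)\<^esub> c"

definition extend_scalars ::
  "'a ring \<Rightarrow> 'b ring \<Rightarrow> ('a \<Rightarrow> 'b) \<Rightarrow> ('a, 'm) module \<Rightarrow>
   ('b, ('b \<times> 'm \<Rightarrow>\<^sub>0 int) set) module" where
  "extend_scalars R S h M =
     (let Q = free_Abelian_group (carrier S \<times> carrier M) Mod tensor_kernel R S h M in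
      \<lparr>carrier = carrier Q, monoid.mult = undefined, monoid.one = undefined,
       ring.zero = monoid.one Q, ring.add = monoid.mult Q,
       module.smult = (\<lambda>b T. \<Union>c\<in>T. tensor_class R S h M (frag_extend (\<lambda>(b', m). frag_of (b \<otimes>\<^bsub>S\<^esub> b', m)) c))\<rparr>)"


subsection \<open>Pullback of sheaves of modules\<close>

text \<open>For \<open>\<phi> = (f, f\<^sup>#) : Z \<rightarrow> Y\<close> the pullback \<open>\<O>\<^sub>Z \<otimes> f\<^sup>-\<^sup>1 F\<close> (tensor product over \<open>f\<^sup>-\<^sup>1 \<O>\<^sub>Y\<close>) is the
  sheaf whose sections over \<open>V\<close> are the families of elements of the stalks
  \<open>\<O>\<^sub>Z\<^sub>,\<^sub>z \<otimes> F\<^sub>f\<^sub>(\<^sub>z\<^sub>)\<close> (over \<open>\<O>\<^sub>Y\<^sub>,\<^sub>f\<^sub>(\<^sub>z\<^sub>)\<close>), \<open>z \<in> V\<close>, that are locally given by a finite sum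
  \<open>\<Sum> n\<^sub>k a\<^sub>k \<otimes> s\<^sub>k\<close> with \<open>a\<^sub>k \<in> \<O>\<^sub>Z(W)\<close>, \<open>s\<^sub>k \<in> F(U)\<close> and \<open>f(W) \<subseteq> U\<close>.\<close>

type_synonym ('z, 'y, 'b, 'm) pb_elem =
  "(('z set \<times> 'b) set \<times> ('y set \<times> 'm) set \<Rightarrow>\<^sub>0 int) set"

definition pb_stalk ::
  "('z, 'b) ringed_space \<Rightarrow> ('y, 'a) ringed_space \<Rightarrow> ('z, 'y, 'a, 'b) rs_map \<Rightarrow>
   ('y, 'a, 'm) mod_sheaf \<Rightarrow> 'z \<Rightarrow>
   (('z set \<times> 'b) set, ('z, 'y, 'b, 'm) pb_elem) module" where
  "pb_stalk Z Y \<phi> F z =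
     extend_scalars (stalk_ring Y (fst \<phi> z)) (stalk_ring Z z) (stalk_map Z Y \<phi> z)
       (stalk_module Y F (fst \<phi> z))"

definition pb_class ::
  "('z, 'b) ringed_space \<Rightarrow> ('y, 'a) ringed_space \<Rightarrow> ('z, 'y, 'a, 'b) rs_map \<Rightarrow>
   ('y, 'a, 'm) mod_sheaf \<Rightarrow> 'z \<Rightarrow>
   (('z set \<times> 'b) set \<times> ('y set \<times> 'm) set \<Rightarrow>\<^sub>0 int) \<Rightarrow> ('z, 'y, 'b, 'm) pb_elem" where
  "pb_class Z Y \<phi> F z =
     tensor_class (stalk_ring Y (fst \<phi> z)) (stalk_ring Z z) (stalk_map Z Y \<phi> z)
       (stalk_module Y F (fst \<phi> z))"

definition pb_sections ::
  "('z, 'b) ringed_space \<Rightarrow> ('y, 'a) ringed_space \<Rightarrow> ('z, 'y, 'a, 'b) rs_map \<Rightarrow>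
   ('y, 'a, 'm) mod_sheaf \<Rightarrow> 'z set \<Rightarrow> ('z \<Rightarrow> ('z, 'y, 'b, 'm) pb_elem) set" where
  "pb_sections Z Y \<phi> F V =
     {t \<in> (\<Pi>\<^sub>E z\<in>V. carrier (pb_stalk Z Y \<phi> F z)).
        \<forall>z\<in>V. \<exists>W U c. openin (spc Z) W \<and> z \<in> W \<and> W \<subseteq> V \<and> openin (spc Y) U \<and> fst \<phi> ` W \<subseteq> U \<and>
          c \<in> carrier (free_Abelian_group (carrier (osec Z W) \<times> carrier (msec F U))) \<and>
          (\<forall>w\<in>W. t w = pb_class Z Y \<phi> F w
             (frag_extend (\<lambda>(a, s). frag_of (ogerm Z w (W, a), mgerm Y F (fst \<phi> w) (U, s))) c))}"

text \<open>All sheaves of modules considered have their sections in one type \<open>'m\<close>.  The pullback is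
  moved back into \<open>'m\<close> along some injection of its sections, which exists as soon as \<open>'m\<close> is
  large enough.\<close>

definition pb_enc ::
  "('z, 'b) ringed_space \<Rightarrow> ('y, 'a) ringed_space \<Rightarrow> ('z, 'y, 'a, 'b) rs_map \<Rightarrow>
   ('y, 'a, 'm) mod_sheaf \<Rightarrow> 'z set \<Rightarrow> ('z \<Rightarrow> ('z, 'y, 'b, 'm) pb_elem) \<Rightarrow> 'm" where
  "pb_enc Z Y \<phi> F V = (SOME e. inj_on e (pb_sections Z Y \<phi> F V))"

definition pb_dec ::
  "('z, 'b) ringed_space \<Rightarrow> ('y, 'a) ringed_space \<Rightarrow> ('z, 'y, 'a, 'b) rs_map \<Rightarrow>
   ('y, 'a, 'm) mod_sheaf \<Rightarrow> 'z set \<Rightarrow> 'm \<Rightarrow> ('z \<Rightarrow> ('z, 'y, 'b, 'm) pb_elem)" where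
  "pb_dec Z Y \<phi> F V = inv_into (pb_sections Z Y \<phi> F V) (pb_enc Z Y \<phi> F V)"

definition pullback ::
  "('z, 'b) ringed_space \<Rightarrow> ('y, 'a) ringed_space \<Rightarrow> ('z, 'y, 'a, 'b) rs_map \<Rightarrow>
   ('y, 'a, 'm) mod_sheaf \<Rightarrow> ('z, 'b, 'm) mod_sheaf" where
  "pullback Z Y \<phi> F =
     (let enc = pb_enc Z Y \<phi> F; dec = pb_dec Z Y \<phi> F; T = pb_stalk Z Y \<phi> F in
      \<lparr>msec = (\<lambda>V.
         \<lparr>carrier = enc V ` pb_sections Z Y \<phi> F V, monoid.mult = undefined, monoid.one = undefined,
          ring.zero = enc V (\<lambda>z\<in>V. \<zero>\<^bsub>T z\<^esub>),
          ring.add = (\<lambda>s t. enc V (\<lambda>z\<in>V. dec V s z \<oplus>\<^bsub>T z\<^esub> dec V t z)),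
          module.smult = (\<lambda>a s. enc V (\<lambda>z\<in>V. ogerm Z z (V, a) \<odot>\<^bsub>T z\<^esub> dec V s z))\<rparr>),
       mres = (\<lambda>V W s. enc W (restrict (dec V s) W))\<rparr>)"

definition pullback_mor ::
  "('z, 'b) ringed_space \<Rightarrow> ('y, 'a) ringed_space \<Rightarrow> ('z, 'y, 'a, 'b) rs_map \<Rightarrow>
   ('y, 'a, 'm) mod_sheaf \<Rightarrow> ('y, 'a, 'm) mod_sheaf \<Rightarrow>
   ('y, 'm) mod_sheaf_mor \<Rightarrow> ('z, 'm) mod_sheaf_mor" where
  "pullback_mor Z Y \<phi> F G \<psi> =
     (\<lambda>V. if openin (spc Z) V then
        (\<lambda>s\<in>carrier (msec (pullback Z Y \<phi> F) V). pb_enc Z Y \<phi> G V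
           (\<lambda>z\<in>V. \<Union>c\<in>pb_dec Z Y \<phi> F V s z.
              pb_class Z Y \<phi> G z
                (frag_extend (\<lambda>(b, m). frag_of (b, stalk_mor Y G \<psi> (fst \<phi> z) m)) c)))
      else undefined)"

text \<open>The unit \<open>s \<mapsto> 1 \<otimes> s\<close> of the adjunction between pullback and pushforward, as a map
  \<open>F(U) \<rightarrow> (f\<^sup>* F)(f\<^sup>-\<^sup>1 U)\<close>.\<close>

definition pb_unit ::
  "('z, 'b) ringed_space \<Rightarrow> ('y, 'a) ringed_space \<Rightarrow> ('z, 'y, 'a, 'b) rs_map \<Rightarrow>
   ('y, 'a, 'm) mod_sheaf \<Rightarrow> 'y set \<Rightarrow> 'm \<Rightarrow> 'm" where
  "pb_unit Z Y \<phi> F U s =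
     pb_enc Z Y \<phi> F (preim Z \<phi> U)
       (\<lambda>z\<in>preim Z \<phi> U. pb_class Z Y \<phi> F z
          (frag_of (\<one>\<^bsub>stalk_ring Z z\<^esub>, mgerm Y F (fst \<phi> z) (U, s))))"

text \<open>The canonical isomorphism \<open>(f g)\<^sup>* F \<cong> g\<^sup>* f\<^sup>* F\<close> for \<open>g : Z \<rightarrow> Y\<close>, \<open>f : Y \<rightarrow> X\<close> with composite
  \<open>h = f g\<close>: the unique morphism compatible with the units, i.e. with \<open>1 \<otimes> s \<mapsto> 1 \<otimes> (1 \<otimes> s)\<close>.
  Likewise \<open>id\<^sup>* F \<cong> F\<close> is the unique morphism with \<open>1 \<otimes> s \<mapsto> s\<close>.\<close>

definition pb_comp_iso ::
  "('z, 'c) ringed_space \<Rightarrow> ('y, 'b) ringed_space \<Rightarrow> ('x, 'a) ringed_space \<Rightarrow>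
   ('z, 'y, 'b, 'c) rs_map \<Rightarrow> ('y, 'x, 'a, 'b) rs_map \<Rightarrow> ('z, 'x, 'a, 'c) rs_map \<Rightarrow>
   ('x, 'a, 'm) mod_sheaf \<Rightarrow> ('z, 'm) mod_sheaf_mor" where
  "pb_comp_iso Z Y X g f h F =
     (THE \<psi>. \<psi> \<in> mod_sheaf_hom Z (pullback Z X h F) (pullback Z Y g (pullback Y X f F)) \<and>
        (\<forall>U. openin (spc X) U \<longrightarrow> (\<forall>s\<in>carrier (msec F U).
           \<psi> (preim Z h U) (pb_unit Z X h F U s) =
           pb_unit Z Y g (pullback Y X f F) (preim Y f U) (pb_unit Y X f F U s))))"

definition pb_id_iso ::
  "('y, 'a) ringed_space \<Rightarrow> ('y, 'y, 'a, 'a) rs_map \<Rightarrow> ('y, 'a, 'm) mod_sheaf \<Rightarrow>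
   ('y, 'm) mod_sheaf_mor" where
  "pb_id_iso Y \<iota> F =
     (THE \<psi>. \<psi> \<in> mod_sheaf_hom Y (pullback Y Y \<iota> F) F \<and>
        (\<forall>U. openin (spc Y) U \<longrightarrow> (\<forall>s\<in>carrier (msec F U). \<psi> U (pb_unit Y Y \<iota> F U s) = s)))"


subsection \<open>Cochain complexes of sheaves of modules\<close>

record ('y, 'a, 'm) sheaf_cpx =
  deg :: "int \<Rightarrow> ('y, 'a, 'm) mod_sheaf"
  dif :: "int \<Rightarrow> ('y, 'm) mod_sheaf_mor"

definition is_sheaf_cpx :: "('y, 'a) ringed_space \<Rightarrow> ('y, 'a, 'm) sheaf_cpx \<Rightarrow> bool" where
  "is_sheaf_cpx Y A \<longleftrightarrow>
     (\<forall>i. is_mod_sheaf Y (deg A i) \<and> dif A i \<in> mod_sheaf_hom Y (deg A i) (deg A (i + 1)) \<and>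
        (\<forall>U. openin (spc Y) U \<longrightarrow> (\<forall>s\<in>carrier (msec (deg A i) U).
           dif A (i + 1) U (dif A i U s) = \<zero>\<^bsub>msec (deg A (i + 1 + 1)) U\<^esub>)))"

definition sheaf_cpx_hom ::
  "('y, 'a) ringed_space \<Rightarrow> ('y, 'a, 'm) sheaf_cpx \<Rightarrow> ('y, 'a, 'm) sheaf_cpx \<Rightarrow>
   (int \<Rightarrow> ('y, 'm) mod_sheaf_mor) set" where
  "sheaf_cpx_hom Y A B =
     {\<psi>. \<forall>i. \<psi> i \<in> mod_sheaf_hom Y (deg A i) (deg B i) \<and>
        mod_sheaf_comp Y (deg A i) (\<psi> (i + 1)) (dif A i) =
        mod_sheaf_comp Y (deg A i) (dif B i) (\<psi> i)}"

definition Sh ::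
  "('y, 'a) ringed_space \<Rightarrow> (('y, 'a, 'm) sheaf_cpx, int \<Rightarrow> ('y, 'm) mod_sheaf_mor) cat" where
  "Sh Y = \<lparr>Obj = {A. is_sheaf_cpx Y A}, Mor = sheaf_cpx_hom Y,
           Ide = (\<lambda>A i. mod_sheaf_id Y (deg A i)),
           Cmp = (\<lambda>A B C \<xi> \<psi> i. mod_sheaf_comp Y (deg A i) (\<xi> i) (\<psi> i))\<rparr>"

definition cocycles :: "('y, 'a, 'm) sheaf_cpx \<Rightarrow> int \<Rightarrow> 'y set \<Rightarrow> 'm set" where
  "cocycles A i U = {s \<in> carrier (msec (deg A i) U). dif A i U s = \<zero>\<^bsub>msec (deg A (i + 1)) U\<^esub>}"

definition coboundaries :: "('y, 'a, 'm) sheaf_cpx \<Rightarrow> int \<Rightarrow> 'y set \<Rightarrow> 'm set" where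
  "coboundaries A i U = dif A (i - 1) U ` carrier (msec (deg A (i - 1)) U)"

definition coh_class :: "('y, 'a, 'm) sheaf_cpx \<Rightarrow> int \<Rightarrow> 'y set \<Rightarrow> 'm \<Rightarrow> 'm set" where
  "coh_class A i U s = coboundaries A i U +>\<^bsub>msec (deg A i) U\<^esub> s"

text \<open>The presheaf \<open>U \<mapsto> H\<^sup>i(A(U))\<close>; the cohomology sheaf is the associated sheaf.\<close>

definition coh_presheaf :: "('y, 'a, 'm) sheaf_cpx \<Rightarrow> int \<Rightarrow> 'y set \<Rightarrow> 'm set set" where
  "coh_presheaf A i U = coh_class A i U ` cocycles A i U"

definition coh_res ::
  "('y, 'a, 'm) sheaf_cpx \<Rightarrow> int \<Rightarrow> 'y set \<Rightarrow> 'y set \<Rightarrow> 'm set \<Rightarrow> 'm set" where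
  "coh_res A i U V T = (\<Union>s\<in>T. coh_class A i V (mres (deg A i) U V s))"

definition coh_sheaf ::
  "('y, 'a) ringed_space \<Rightarrow> ('y, 'a, 'm) sheaf_cpx \<Rightarrow> int \<Rightarrow> 'y set \<Rightarrow>
   ('y \<Rightarrow> ('y set \<times> 'm set) set) set" where
  "coh_sheaf Y A i = associated_sections (spc Y) (coh_presheaf A i) (coh_res A i)"

definition coh_sheaf_map ::
  "('y, 'a) ringed_space \<Rightarrow> ('y, 'a, 'm) sheaf_cpx \<Rightarrow> (int \<Rightarrow> ('y, 'm) mod_sheaf_mor) \<Rightarrow> int \<Rightarrow>
   'y set \<Rightarrow> ('y \<Rightarrow> ('y set \<times> 'm set) set) \<Rightarrow> ('y \<Rightarrow> ('y set \<times> 'm set) set)" where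
  "coh_sheaf_map Y B \<psi> i V t =
     (\<lambda>y\<in>V. \<Union>(U, T)\<in>t y.
        germ (spc Y) (coh_presheaf B i) (coh_res B i) y (U, \<Union>s\<in>T. coh_class B i U (\<psi> i U s)))"

text \<open>A module homomorphism of sheaves is an isomorphism iff it is bijective on sections.\<close>

definition quasi_iso ::
  "('y, 'a) ringed_space \<Rightarrow> ('y, 'a, 'm) sheaf_cpx \<Rightarrow> ('y, 'a, 'm) sheaf_cpx \<Rightarrow>
   (int \<Rightarrow> ('y, 'm) mod_sheaf_mor) \<Rightarrow> bool" where
  "quasi_iso Y A B \<psi> \<longleftrightarrow> \<psi> \<in> sheaf_cpx_hom Y A B \<and>
     (\<forall>i V. openin (spc Y) V \<longrightarrow>
        bij_betw (coh_sheaf_map Y B \<psi> i V) (coh_sheaf Y A i V) (coh_sheaf Y B i V))"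

definition pullback_cpx ::
  "('z, 'b) ringed_space \<Rightarrow> ('y, 'a) ringed_space \<Rightarrow> ('z, 'y, 'a, 'b) rs_map \<Rightarrow>
   ('y, 'a, 'm) sheaf_cpx \<Rightarrow> ('z, 'b, 'm) sheaf_cpx" where
  "pullback_cpx Z Y \<phi> A =
     \<lparr>deg = (\<lambda>i. pullback Z Y \<phi> (deg A i)),
      dif = (\<lambda>i. pullback_mor Z Y \<phi> (deg A i) (deg A (i + 1)) (dif A i))\<rparr>"

definition pullback_cpx_mor ::
  "('z, 'b) ringed_space \<Rightarrow> ('y, 'a) ringed_space \<Rightarrow> ('z, 'y, 'a, 'b) rs_map \<Rightarrow>
   ('y, 'a, 'm) sheaf_cpx \<Rightarrow> ('y, 'a, 'm) sheaf_cpx \<Rightarrow>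
   (int \<Rightarrow> ('y, 'm) mod_sheaf_mor) \<Rightarrow> (int \<Rightarrow> ('z, 'm) mod_sheaf_mor)" where
  "pullback_cpx_mor Z Y \<phi> A B \<psi> = (\<lambda>i. pullback_mor Z Y \<phi> (deg A i) (deg B i) (\<psi> i))"


section \<open>The Cech nerve\<close>

definition locally_finite_open_cover ::
  "('x, 'r) ringed_space \<Rightarrow> 'i set \<Rightarrow> ('i \<Rightarrow> 'x set) \<Rightarrow> bool" where
  "locally_finite_open_cover X I U \<longleftrightarrow>
     (\<forall>i\<in>I. openin (spc X) (U i)) \<and> (\<Union>i\<in>I. U i) = topspace (spc X) \<and>
     (\<forall>x\<in>topspace (spc X). \<exists>V. openin (spc X) V \<and> x \<in> V \<and> finite {i \<in> I. U i \<inter> V \<noteq> {}})"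

text \<open>\<open>X\<^sub>p\<close> is the disjoint union of the intersections \<open>U (\<sigma> 0) \<inter> \<dots> \<inter> U (\<sigma> p)\<close>; its points are the
  pairs \<open>(\<sigma>, x)\<close>, and the canonical map to \<open>X\<close> is \<open>snd\<close>.\<close>

type_synonym ('i, 'x) cech_point = "(nat \<Rightarrow> 'i) \<times> 'x"
type_synonym ('i, 'x, 'r) cech_fun = "('i, 'x) cech_point \<Rightarrow> ('x set \<times> 'r) set"

definition cech_nerve ::
  "('x, 'r) ringed_space \<Rightarrow> 'i set \<Rightarrow> ('i \<Rightarrow> 'x set) \<Rightarrow> nat \<Rightarrow>
   (('i, 'x) cech_point, ('i, 'x, 'r) cech_fun) ringed_space" where
  "cech_nerve X I U p =
     inverse_image_space snd
       (sum_topology (\<lambda>\<sigma>. subtopology (spc X) (\<Inter>k\<in>{..p}. U (\<sigma> k))) ({..p} \<rightarrow>\<^sub>E I)) X"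

text \<open>The map \<open>X\<^sub>q \<rightarrow> X\<^sub>p\<close> induced by \<open>\<alpha> : [p] \<rightarrow> [q]\<close>.  Since it lies over \<open>X\<close>, its effect on the
  structure sheaves is composition.\<close>

definition cech_map ::
  "('x, 'r) ringed_space \<Rightarrow> 'i set \<Rightarrow> ('i \<Rightarrow> 'x set) \<Rightarrow> nat \<Rightarrow> nat \<Rightarrow> (nat \<Rightarrow> nat) \<Rightarrow>
   (('i, 'x) cech_point, ('i, 'x) cech_point, ('i, 'x, 'r) cech_fun, ('i, 'x, 'r) cech_fun) rs_map"
  where
  "cech_map X I U p q \<alpha> =
     (let f = (\<lambda>(\<sigma>, x). (compose {..p} \<sigma> \<alpha>, x)) in
      (f, \<lambda>V t. \<lambda>y\<in>{y \<in> topspace (spc (cech_nerve X I U q)). f y \<in> V}. t (f y)))"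

abbreviation cech_pb where
  "cech_pb X I U p q \<alpha> \<equiv>
     pullback (cech_nerve X I U q) (cech_nerve X I U p) (cech_map X I U p q \<alpha>)"

abbreviation cech_pb_mor where
  "cech_pb_mor X I U p q \<alpha> \<equiv>
     pullback_mor (cech_nerve X I U q) (cech_nerve X I U p) (cech_map X I U p q \<alpha>)"

abbreviation cech_pb_cpx where
  "cech_pb_cpx X I U p q \<alpha> \<equiv>
     pullback_cpx (cech_nerve X I U q) (cech_nerve X I U p) (cech_map X I U p q \<alpha>)"

abbreviation cech_pb_cpx_mor where
  "cech_pb_cpx_mor X I U p q \<alpha> \<equiv>
     pullback_cpx_mor (cech_nerve X I U q) (cech_nerve X I U p) (cech_map X I U p q \<alpha>)"

definition cech_comp_iso ::
  "('x, 'r) ringed_space \<Rightarrow> 'i set \<Rightarrow> ('i \<Rightarrow> 'x set) \<Rightarrow> nat \<Rightarrow> nat \<Rightarrow> nat \<Rightarrow>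
   (nat \<Rightarrow> nat) \<Rightarrow> (nat \<Rightarrow> nat) \<Rightarrow>
   (('i, 'x) cech_point, ('i, 'x, 'r) cech_fun, 'm) mod_sheaf \<Rightarrow>
   (('i, 'x) cech_point, 'm) mod_sheaf_mor" where
  "cech_comp_iso X I U p q r \<beta> \<alpha> =
     pb_comp_iso (cech_nerve X I U r) (cech_nerve X I U q) (cech_nerve X I U p)
       (cech_map X I U q r \<beta>) (cech_map X I U p q \<alpha>) (cech_map X I U p r (compose {..p} \<beta> \<alpha>))"

definition cech_id_iso ::
  "('x, 'r) ringed_space \<Rightarrow> 'i set \<Rightarrow> ('i \<Rightarrow> 'x set) \<Rightarrow> nat \<Rightarrow>
   (('i, 'x) cech_point, ('i, 'x, 'r) cech_fun, 'm) mod_sheaf \<Rightarrow>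
   (('i, 'x) cech_point, 'm) mod_sheaf_mor" where
  "cech_id_iso X I U p = pb_id_iso (cech_nerve X I U p) (cech_map X I U p p (\<lambda>i\<in>{..p}. i))"

type_synonym ('i, 'x, 'r, 'm) cech_cpx =
  "(('i, 'x) cech_point, ('i, 'x, 'r) cech_fun, 'm) sheaf_cpx"
type_synonym ('i, 'x, 'm) cech_cpx_mor = "int \<Rightarrow> (('i, 'x) cech_point, 'm) mod_sheaf_mor"
type_synonym ('i, 'x, 'r, 'm) cech_mor_class =
  "('i, 'x, 'r, 'm) cech_cpx \<Rightarrow> ('i, 'x, 'r, 'm) cech_cpx \<Rightarrow> ('i, 'x, 'm) cech_cpx_mor set"

text \<open>The diagram \<open>[p] \<mapsto> Sh(X\<^sub>p)\<close>, where \<open>W p\<close>, \<open>Co p\<close>, \<open>Fi p\<close> are the weak equivalences,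
  cofibrations and fibrations of \<open>Sh(X\<^sub>p)\<close>.\<close>

definition cech_model_cat ::
  "('x, 'r) ringed_space \<Rightarrow> 'i set \<Rightarrow> ('i \<Rightarrow> 'x set) \<Rightarrow>
   (nat \<Rightarrow> ('i, 'x, 'r, 'm) cech_mor_class) \<Rightarrow> (nat \<Rightarrow> ('i, 'x, 'r, 'm) cech_mor_class) \<Rightarrow>
   (nat \<Rightarrow> ('i, 'x, 'r, 'm) cech_mor_class) \<Rightarrow> nat \<Rightarrow>
   (('i, 'x, 'r, 'm) cech_cpx, ('i, 'x, 'm) cech_cpx_mor) model_cat" where
  "cech_model_cat X I U W Co Fi p =
     with_model_structure (Sh (cech_nerve X I U p)) (W p) (Co p) (Fi p)"

definition cech_diagram ::
  "('x, 'r) ringed_space \<Rightarrow> 'i set \<Rightarrow> ('i \<Rightarrow> 'x set) \<Rightarrow>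
   (nat \<Rightarrow> ('i, 'x, 'r, 'm) cech_mor_class) \<Rightarrow> (nat \<Rightarrow> ('i, 'x, 'r, 'm) cech_mor_class) \<Rightarrow>
   (nat \<Rightarrow> ('i, 'x, 'r, 'm) cech_mor_class) \<Rightarrow>
   (nat, nat \<Rightarrow> nat, ('i, 'x, 'r, 'm) cech_cpx, ('i, 'x, 'm) cech_cpx_mor) model_diagram" where
  "cech_diagram X I U W Co Fi =
     \<lparr>shape = Simplex, mcat = cech_model_cat X I U W Co Fi,
      fobj = (\<lambda>p q \<alpha>. cech_pb_cpx X I U p q \<alpha>),
      fmor = (\<lambda>p q \<alpha>. cech_pb_cpx_mor X I U p q \<alpha>),
      fcmp = (\<lambda>p q r \<beta> \<alpha> A i. cech_comp_iso X I U p q r \<beta> \<alpha> (deg A i)),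
      funit = (\<lambda>p A i. cech_id_iso X I U p (deg A i))\<rparr>"


subsection \<open>Complexes of sheaves on the Cech nerve\<close>

record ('i, 'x, 'r, 'm) simplicial_cpx =
  lvl :: "nat \<Rightarrow> ('i, 'x, 'r, 'm) cech_cpx"
  act :: "nat \<Rightarrow> nat \<Rightarrow> (nat \<Rightarrow> nat) \<Rightarrow> ('i, 'x, 'm) cech_cpx_mor"

definition is_simplicial_cpx ::
  "('x, 'r) ringed_space \<Rightarrow> 'i set \<Rightarrow> ('i \<Rightarrow> 'x set) \<Rightarrow> ('i, 'x, 'r, 'm) simplicial_cpx \<Rightarrow> bool" where
  "is_simplicial_cpx X I U F \<longleftrightarrow>
     (\<forall>p. is_sheaf_cpx (cech_nerve X I U p) (lvl F p)) \<and>
     (\<forall>p q \<alpha>. \<alpha> \<notin> Mor Simplex p q \<longrightarrow> act F p q \<alpha> = undefined) \<and>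
     (\<forall>p q. \<forall>\<alpha>\<in>Mor Simplex p q.
        act F p q \<alpha> \<in> sheaf_cpx_hom (cech_nerve X I U q) (cech_pb_cpx X I U p q \<alpha> (lvl F p)) (lvl F q)) \<and>
     (\<forall>p i. act F p p (Ide Simplex p) i = cech_id_iso X I U p (deg (lvl F p) i)) \<and>
     (\<forall>p q r. \<forall>\<alpha>\<in>Mor Simplex p q. \<forall>\<beta>\<in>Mor Simplex q r. \<forall>i.
        (let \<beta>\<alpha> = Cmp Simplex p q r \<beta> \<alpha>; Fp = deg (lvl F p) i; Fq = deg (lvl F q) i;
             \<alpha>Fp = cech_pb X I U p q \<alpha> Fp in
         act F p r \<beta>\<alpha> i =
           mod_sheaf_comp (cech_nerve X I U r) (cech_pb X I U p r \<beta>\<alpha> Fp)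
             (mod_sheaf_comp (cech_nerve X I U r) (cech_pb X I U q r \<beta> \<alpha>Fp)
                (act F q r \<beta> i) (cech_pb_mor X I U q r \<beta> \<alpha>Fp Fq (act F p q \<alpha> i)))
             (cech_comp_iso X I U p q r \<beta> \<alpha> Fp)))"

definition simplicial_cpx_hom ::
  "('x, 'r) ringed_space \<Rightarrow> 'i set \<Rightarrow> ('i \<Rightarrow> 'x set) \<Rightarrow>
   ('i, 'x, 'r, 'm) simplicial_cpx \<Rightarrow> ('i, 'x, 'r, 'm) simplicial_cpx \<Rightarrow>
   (nat \<Rightarrow> ('i, 'x, 'm) cech_cpx_mor) set" where
  "simplicial_cpx_hom X I U F G =
     {\<psi>. (\<forall>p. \<psi> p \<in> sheaf_cpx_hom (cech_nerve X I U p) (lvl F p) (lvl G p)) \<and>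
        (\<forall>p q. \<forall>\<alpha>\<in>Mor Simplex p q. \<forall>i.
           (let Fp = deg (lvl F p) i; Gp = deg (lvl G p) i; \<alpha>Fp = cech_pb X I U p q \<alpha> Fp in
            mod_sheaf_comp (cech_nerve X I U q) \<alpha>Fp (\<psi> q i) (act F p q \<alpha> i) =
            mod_sheaf_comp (cech_nerve X I U q) \<alpha>Fp (act G p q \<alpha> i)
              (cech_pb_mor X I U p q \<alpha> Fp Gp (\<psi> p i))))}"

definition Sh_simplicial ::
  "('x, 'r) ringed_space \<Rightarrow> 'i set \<Rightarrow> ('i \<Rightarrow> 'x set) \<Rightarrow>
   (('i, 'x, 'r, 'm) simplicial_cpx, nat \<Rightarrow> ('i, 'x, 'm) cech_cpx_mor) cat" where
  "Sh_simplicial X I U =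
     \<lparr>Obj = {F. is_simplicial_cpx X I U F}, Mor = simplicial_cpx_hom X I U,
      Ide = (\<lambda>F p i. mod_sheaf_id (cech_nerve X I U p) (deg (lvl F p) i)),
      Cmp = (\<lambda>F G H \<xi> \<psi> p i.
        mod_sheaf_comp (cech_nerve X I U p) (deg (lvl F p) i) (\<xi> p i) (\<psi> p i))\<rparr>"

definition Sh_cart ::
  "('x, 'r) ringed_space \<Rightarrow> 'i set \<Rightarrow> ('i \<Rightarrow> 'x set) \<Rightarrow>
   (('i, 'x, 'r, 'm) simplicial_cpx, nat \<Rightarrow> ('i, 'x, 'm) cech_cpx_mor) cat" where
  "Sh_cart X I U = full_subcategory (Sh_simplicial X I U)
     (\<lambda>F. \<forall>p q. \<forall>\<alpha>\<in>Mor Simplex p q.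
        quasi_iso (cech_nerve X I U q) (cech_pb_cpx X I U p q \<alpha> (lvl F p)) (lvl F q) (act F p q \<alpha>))"

end

theory Submission
  imports Defs
begin

text \<open>Unfolding the definitions, a simplicial complex of sheaves is literally a pair \<open>(m, u)\<close> of the lax
  homotopy limit, with the same morphisms: \<open>(m, u) \<mapsto> \<lparr>lvl = m, act = u\<rparr>\<close> is an isomorphism of
  categories.  It matches the objects of the homotopy limit with the cartesian ones because the weak
  equivalences are the quasi-isomorphisms.\<close>

text \<open>Hom-sets agree literally, so both functors can leave arrows unchanged, with
  \<open>F\<close> on objects one way and its inverse \<open>G\<close> the other. Every object of
  \<open>D\<close> is some \<open>F x\<close>, so the category laws of \<open>D\<close> are
  inherited from \<open>C\<close>.\<close>

lemma equivalent_categories_relabel: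
  assumes C: "category C" and bij: "bij_betw F (Obj C) (Obj D)"
    and Mor: "\<And>x y. \<lbrakk>x \<in> Obj C; y \<in> Obj C\<rbrakk> \<Longrightarrow> Mor D (F x) (F y) = Mor C x y"
    and Ide: "\<And>x. x \<in> Obj C \<Longrightarrow> Ide D (F x) = Ide C x"
    and Cmp: "\<And>x y z g f. \<lbrakk>x \<in> Obj C; y \<in> Obj C; z \<in> Obj C\<rbrakk> \<Longrightarrow>
      Cmp D (F x) (F y) (F z) g f = Cmp C x y z g f"
  shows "equivalent_categories C D"
proof -
  define G where "G = inv_into (Obj C) F"
  have D_eq: "Obj D = F ` Obj C"
    using bij by (simp add: bij_betw_def)
  have GF: "G (F x) = x" if "x \<in> Obj C" for x
    using bij that by (simp add: G_def bij_betw_def)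
  have D: "category D"
    using C unfolding category_def D_eq by (simp add: Mor Ide Cmp)
  have fun_F: "is_functor C D F (\<lambda>x y f. f)"
    unfolding is_functor_def D_eq by (simp add: Mor Ide Cmp)
  have fun_G: "is_functor D C G (\<lambda>x y f. f)"
    unfolding is_functor_def D_eq by (simp add: Mor Ide Cmp GF)
  have iso_idC: "is_iso C x x (Ide C x)" if "x \<in> Obj C" for x
    using C that by (auto simp: category_def is_iso_def)
  have iso_idD: "is_iso D x x (Ide D x)" if "x \<in> Obj D" for x
    using D that by (auto simp: category_def is_iso_def)
  \<comment> \<open>Since \<open>G (F x) = x\<close>, identities serve as components, and naturality
    reduces to the two unit laws. The same works for \<open>F (G x)\<close>.\<close>
  have "naturally_isomorphic C C (\<lambda>x. G (F x)) (\<lambda>x y f. f) (\<lambda>x. x) (\<lambda>x y f. f)"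
    unfolding naturally_isomorphic_def
    using C iso_idC by (intro exI[of _ "Ide C"]) (simp add: GF category_def)
  moreover have "naturally_isomorphic D D (\<lambda>x. F (G x)) (\<lambda>x y f. f) (\<lambda>x. x) (\<lambda>x y f. f)"
    unfolding naturally_isomorphic_def
    using D iso_idD by (intro exI[of _ "Ide D"]) (simp add: GF category_def D_eq)
  ultimately show ?thesis
    unfolding equivalent_categories_def using C D fun_F fun_G by blast
qed

lemma category_full_subcategory: "category C \<Longrightarrow> category (full_subcategory C P)"
  unfolding category_def full_subcategory_def by simp

text \<open>A full subcategory keeps \<open>Mor\<close>, \<open>Ide\<close> and \<open>Cmp\<close>,
  so only the bijection on objects has to be restricted. Agreement of \<open>P\<close> and
  \<open>Q\<close> is asked on objects of \<open>C\<close> alone, because weak equivalences and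
  quasi-isomorphisms will be compared only between actual complexes.\<close>

lemma equivalent_full_subcategories_relabel:
  fixes C :: "('o, 'a) cat" and D :: "('p, 'a) cat"
  assumes C: "category C" and bij: "bij_betw F (Obj C) (Obj D)"
    and Mor: "\<And>x y. \<lbrakk>x \<in> Obj C; y \<in> Obj C\<rbrakk> \<Longrightarrow> Mor D (F x) (F y) = Mor C x y"
    and Ide: "\<And>x. x \<in> Obj C \<Longrightarrow> Ide D (F x) = Ide C x"
    and Cmp: "\<And>x y z g f. \<lbrakk>x \<in> Obj C; y \<in> Obj C; z \<in> Obj C\<rbrakk> \<Longrightarrow>
      Cmp D (F x) (F y) (F z) g f = Cmp C x y z g f"
    and PQ: "\<And>x. x \<in> Obj C \<Longrightarrow> Q (F x) \<longleftrightarrow> P x"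
  shows "equivalent_categories (full_subcategory C P) (full_subcategory D Q)"
proof (rule equivalent_categories_relabel)
  show "category (full_subcategory C P)"
    using C by (rule category_full_subcategory)
  show "bij_betw F (Obj (full_subcategory C P)) (Obj (full_subcategory D Q))"
    using bij PQ by (force simp: full_subcategory_def bij_betw_def intro: inj_on_subset)
qed (simp_all add: full_subcategory_def Mor Ide Cmp)

text \<open>Identities and composites are formed componentwise, so the unit and associativity laws
  come from each \<open>mcat M d\<close>. Functoriality of \<open>fobj\<close> and
  \<open>fmor\<close> is what makes identities and composites commute with the structure maps
  again.\<close>

lemma category_laxholim:
  assumes cat: "\<And>d. d \<in> Obj (shape M) \<Longrightarrow> category (mcat M d)"
    and fctr: "\<And>d e \<theta>. \<lbrakk>d \<in> Obj (shape M); e \<in> Obj (shape M); \<theta> \<in> Mor (shape M) d e\<rbrakk> \<Longrightarrow>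
      is_functor (mcat M d) (mcat M e) (fobj M d e \<theta>) (fmor M d e \<theta>)"
  shows "category (laxholim M)"
proof -
  let ?D = "shape M" and ?L = "laxholim M"
  have Ide_in: "Ide (mcat M d) x \<in> Mor (mcat M d) x x"
    if "d \<in> Obj ?D" "x \<in> Obj (mcat M d)" for d x
    using cat[OF that(1)] that(2) by (simp add: category_def)
  have Cmp_in: "Cmp (mcat M d) x y z g f \<in> Mor (mcat M d) x z"
    if "d \<in> Obj ?D" "x \<in> Obj (mcat M d)" "y \<in> Obj (mcat M d)" "z \<in> Obj (mcat M d)"
      "f \<in> Mor (mcat M d) x y" "g \<in> Mor (mcat M d) y z" for d x y z f g
    using cat[OF that(1)] that(2-) by (simp add: category_def)
  have units: "Cmp (mcat M d) x x y f (Ide (mcat M d) x) = f"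
    "Cmp (mcat M d) x y y (Ide (mcat M d) y) f = f"
    if "d \<in> Obj ?D" "x \<in> Obj (mcat M d)" "y \<in> Obj (mcat M d)" "f \<in> Mor (mcat M d) x y" for d x y f
    using cat[OF that(1)] that(2-) by (simp_all add: category_def)
  have assoc: "Cmp (mcat M d) w y z h (Cmp (mcat M d) w x y g f) =
      Cmp (mcat M d) w x z (Cmp (mcat M d) x y z h g) f"
    if "d \<in> Obj ?D" "w \<in> Obj (mcat M d)" "x \<in> Obj (mcat M d)" "y \<in> Obj (mcat M d)"
      "z \<in> Obj (mcat M d)" "f \<in> Mor (mcat M d) w x" "g \<in> Mor (mcat M d) x y"
      "h \<in> Mor (mcat M d) y z" for d w x y z f g h
    using cat[OF that(1)] that(2-) by (simp add: category_def)
  have F_in: "fobj M d e \<theta> x \<in> Obj (mcat M e)"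
    "y \<in> Obj (mcat M d) \<Longrightarrow> f \<in> Mor (mcat M d) x y \<Longrightarrow>
      fmor M d e \<theta> x y f \<in> Mor (mcat M e) (fobj M d e \<theta> x) (fobj M d e \<theta> y)"
    and F_Ide: "fmor M d e \<theta> x x (Ide (mcat M d) x) = Ide (mcat M e) (fobj M d e \<theta> x)"
    and F_Cmp: "\<lbrakk>y \<in> Obj (mcat M d); z \<in> Obj (mcat M d); f \<in> Mor (mcat M d) x y;
        g \<in> Mor (mcat M d) y z\<rbrakk> \<Longrightarrow>
      fmor M d e \<theta> x z (Cmp (mcat M d) x y z g f) =
      Cmp (mcat M e) (fobj M d e \<theta> x) (fobj M d e \<theta> y) (fobj M d e \<theta> z)
        (fmor M d e \<theta> y z g) (fmor M d e \<theta> x y f)"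
    if "d \<in> Obj ?D" "e \<in> Obj ?D" "\<theta> \<in> Mor ?D d e" "x \<in> Obj (mcat M d)" for d e \<theta> x y z f g
    using fctr[OF that(1-3)] that(4) by (simp_all add: is_functor_def)
  have obj: "m d \<in> Obj (mcat M d)" if "(m, u) \<in> Obj ?L" "d \<in> Obj ?D" for m u d
    using that by (auto simp: laxholim_def laxholim_objects_def Let_def)
  have str: "u d e \<theta> \<in> Mor (mcat M e) (fobj M d e \<theta> (m d)) (m e)"
    if "(m, u) \<in> Obj ?L" "d \<in> Obj ?D" "e \<in> Obj ?D" "\<theta> \<in> Mor ?D d e" for m u d e \<theta>
    using that by (simp add: laxholim_def laxholim_objects_def Let_def)
  have Mor_L: "x \<in> Mor ?L (m, u) (m', u') \<longleftrightarrow>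
      x \<in> (\<Pi>\<^sub>E d\<in>Obj ?D. Mor (mcat M d) (m d) (m' d)) \<and>
      (\<forall>d\<in>Obj ?D. \<forall>e\<in>Obj ?D. \<forall>\<theta>\<in>Mor ?D d e.
         Cmp (mcat M e) (fobj M d e \<theta> (m d)) (m e) (m' e) (x e) (u d e \<theta>) =
         Cmp (mcat M e) (fobj M d e \<theta> (m d)) (fobj M d e \<theta> (m' d)) (m' e)
           (u' d e \<theta>) (fmor M d e \<theta> (m d) (m' d) (x d)))" for x m u m' u'
    by (simp add: laxholim_def Let_def)
  have Mor_at: "x d \<in> Mor (mcat M d) (m d) (m' d)"
    if "x \<in> Mor ?L (m, u) (m', u')" "d \<in> Obj ?D" for x m u m' u' d
    using that unfolding Mor_L by auto
  \<comment> \<open>Composition in the lax limit is restricted to \<open>Obj ?D\<close>. The unit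
    laws are equalities of functions, so the values of a morphism elsewhere must be the same
    default.\<close>
  have Mor_undef: "x d = undefined"
    if "x \<in> Mor ?L (m, u) (m', u')" "d \<notin> Obj ?D" for x m u m' u' d
    using that unfolding Mor_L by (auto simp: PiE_def extensional_def)
  have Ide_L: "Ide ?L (m, u) = (\<lambda>d\<in>Obj ?D. Ide (mcat M d) (m d))" for m u
    by (simp add: laxholim_def Let_def)
  have Cmp_L: "Cmp ?L (m, u) (m', u') (m'', u'') y x =
      (\<lambda>d\<in>Obj ?D. Cmp (mcat M d) (m d) (m' d) (m'' d) (y d) (x d))" for m u m' u' m'' u'' y x
    by (simp add: laxholim_def Let_def)
  \<comment> \<open>\<open>F_Ide\<close> turns the image of an identity into an identity, so both
    sides of the square collapse to \<open>u d e \<theta>\<close>.\<close>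
  have Ide_Mor: "Ide ?L (m, u) \<in> Mor ?L (m, u) (m, u)" if L: "(m, u) \<in> Obj ?L" for m u
    unfolding Mor_L Ide_L using L obj str F_in F_Ide Ide_in units by auto
  have Cmp_Mor: "Cmp ?L (m, u) (m', u') (m'', u'') y x \<in> Mor ?L (m, u) (m'', u'')"
    if L: "(m, u) \<in> Obj ?L" "(m', u') \<in> Obj ?L" "(m'', u'') \<in> Obj ?L"
      and x: "x \<in> Mor ?L (m, u) (m', u')" and y: "y \<in> Mor ?L (m', u') (m'', u'')"
    for m u m' u' m'' u'' x y
    unfolding Mor_L Cmp_L
  proof (intro conjI ballI)
    fix d e \<theta> assume d: "d \<in> Obj ?D" and e: "e \<in> Obj ?D" and \<theta>: "\<theta> \<in> Mor ?D d e"
    let ?C = "Cmp (mcat M e)" and ?F = "fobj M d e \<theta>" and ?f = "fmor M d e \<theta>"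
    note objs = obj[OF L(1) d] obj[OF L(2) d] obj[OF L(3) d]
      obj[OF L(1) e] obj[OF L(2) e] obj[OF L(3) e]
    note Fobjs = F_in(1)[OF d e \<theta> objs(1)] F_in(1)[OF d e \<theta> objs(2)] F_in(1)[OF d e \<theta> objs(3)]
    note us = str[OF L(1) d e \<theta>] str[OF L(2) d e \<theta>] str[OF L(3) d e \<theta>]
    note mors = Mor_at[OF x d] Mor_at[OF x e] Mor_at[OF y d] Mor_at[OF y e]
    note fx = F_in(2)[OF d e \<theta> objs(1,2) mors(1)] and fy = F_in(2)[OF d e \<theta> objs(2,3) mors(3)]
    \<comment> \<open>The squares of \<open>x\<close> and \<open>y\<close> are pasted: three
      rebracketings alternate with the two squares, and functoriality finally merges the images of
      \<open>x d\<close> and \<open>y d\<close>.\<close>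
    have "?C (?F (m d)) (m e) (m'' e) (?C (m e) (m' e) (m'' e) (y e) (x e)) (u d e \<theta>) =
        ?C (?F (m d)) (m' e) (m'' e) (y e) (?C (?F (m d)) (m e) (m' e) (x e) (u d e \<theta>))"
      using assoc[OF e Fobjs(1) objs(4,5,6) us(1) mors(2,4)] by simp
    also have "\<dots> = ?C (?F (m d)) (m' e) (m'' e) (y e)
        (?C (?F (m d)) (?F (m' d)) (m' e) (u' d e \<theta>) (?f (m d) (m' d) (x d)))"
      using x d e \<theta> by (simp add: Mor_L)
    also have "\<dots> = ?C (?F (m d)) (?F (m' d)) (m'' e)
        (?C (?F (m' d)) (m' e) (m'' e) (y e) (u' d e \<theta>)) (?f (m d) (m' d) (x d))"
      by (rule assoc[OF e Fobjs(1,2) objs(5,6) fx us(2) mors(4)])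
    also have "\<dots> = ?C (?F (m d)) (?F (m' d)) (m'' e)
        (?C (?F (m' d)) (?F (m'' d)) (m'' e) (u'' d e \<theta>) (?f (m' d) (m'' d) (y d)))
        (?f (m d) (m' d) (x d))"
      using y d e \<theta> by (simp add: Mor_L)
    also have "\<dots> = ?C (?F (m d)) (?F (m'' d)) (m'' e) (u'' d e \<theta>)
        (?C (?F (m d)) (?F (m' d)) (?F (m'' d)) (?f (m' d) (m'' d) (y d)) (?f (m d) (m' d) (x d)))"
      by (rule assoc[OF e Fobjs objs(6) fx fy us(3), symmetric])
    also have "?C (?F (m d)) (?F (m' d)) (?F (m'' d)) (?f (m' d) (m'' d) (y d)) (?f (m d) (m' d) (x d))
        = ?f (m d) (m'' d) (Cmp (mcat M d) (m d) (m' d) (m'' d) (y d) (x d))"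
      by (rule F_Cmp[OF d e \<theta> objs(1,2,3) mors(1,3), symmetric])
    finally show "?C (?F (m d)) (m e) (m'' e)
        ((\<lambda>d\<in>Obj ?D. Cmp (mcat M d) (m d) (m' d) (m'' d) (y d) (x d)) e) (u d e \<theta>) =
      ?C (?F (m d)) (?F (m'' d)) (m'' e) (u'' d e \<theta>)
        (?f (m d) (m'' d) ((\<lambda>d\<in>Obj ?D. Cmp (mcat M d) (m d) (m' d) (m'' d) (y d) (x d)) d))"
      using d e by simp
  qed (use Cmp_in obj[OF L(1)] obj[OF L(2)] obj[OF L(3)] Mor_at[OF x] Mor_at[OF y] in auto)
  have Cmp_Ide: "Cmp ?L (m, u) (m, u) (m', u') x (Ide ?L (m, u)) = x"
    "Cmp ?L (m, u) (m', u') (m', u') (Ide ?L (m', u')) x = x"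
    if L: "(m, u) \<in> Obj ?L" "(m', u') \<in> Obj ?L" and x: "x \<in> Mor ?L (m, u) (m', u')" for m u m' u' x
    by (simp_all add: Cmp_L Ide_L fun_eq_iff restrict_def units obj[OF L(1)] obj[OF L(2)]
        Mor_at[OF x] Mor_undef[OF x])
  have Cmp_assoc: "Cmp ?L (m, u) (m'', u'') (m''', u''') z (Cmp ?L (m, u) (m', u') (m'', u'') y x) =
      Cmp ?L (m, u) (m', u') (m''', u''') (Cmp ?L (m', u') (m'', u'') (m''', u''') z y) x"
    if L: "(m, u) \<in> Obj ?L" "(m', u') \<in> Obj ?L" "(m'', u'') \<in> Obj ?L" "(m''', u''') \<in> Obj ?L"
      and x: "x \<in> Mor ?L (m, u) (m', u')" and y: "y \<in> Mor ?L (m', u') (m'', u'')"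
      and z: "z \<in> Mor ?L (m'', u'') (m''', u''')"
    for m u m' u' m'' u'' m''' u''' x y z
    unfolding Cmp_L
    by (rule restrict_ext) (simp add: assoc obj[OF L(1)] obj[OF L(2)] obj[OF L(3)] obj[OF L(4)]
        Mor_at[OF x] Mor_at[OF y] Mor_at[OF z])
  show ?thesis
    unfolding category_def
    by (simp add: split_paired_all Ball_def Ide_Mor Cmp_Mor Cmp_Ide Cmp_assoc)
qed

theorem lemma4p4:
  fixes X :: "('x, 'r) ringed_space"
    and I :: "'i set" and U :: "'i \<Rightarrow> 'x set"
    and W Co Fi :: "nat \<Rightarrow> ('i, 'x, 'r, 'm) cech_mor_class"
  assumes X: "locally_ringed_space X"
    and U: "locally_finite_open_cover X I U"
    and small: "infinite (UNIV :: 'k set)" "topspace (spc X) \<lesssim> (UNIV :: 'k set)"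
      "I \<lesssim> (UNIV :: 'k set)"
      "\<And>V. openin (spc X) V \<Longrightarrow> carrier (osec X V) \<lesssim> (UNIV :: 'k set)"
      "(UNIV :: ('k \<Rightarrow> 'm) set) \<lesssim> (UNIV :: 'm set)"
    and model: "\<And>p. model_category TYPE('k) (cech_model_cat X I U W Co Fi p)"
    and cofib_gen: "\<And>p. cofibrantly_generated TYPE('k) (cech_model_cat X I U W Co Fi p)"
    and weq: "\<And>p A B \<psi>. is_sheaf_cpx (cech_nerve X I U p) A \<Longrightarrow> is_sheaf_cpx (cech_nerve X I U p) B \<Longrightarrow>
      \<psi> \<in> W p A B \<longleftrightarrow> quasi_iso (cech_nerve X I U p) A B \<psi>"
    and quillen: "\<And>p q \<alpha>. \<alpha> \<in> Mor Simplex p q \<Longrightarrow>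
      left_quillen (cech_model_cat X I U W Co Fi p) (cech_model_cat X I U W Co Fi q)
        (cech_pb_cpx X I U p q \<alpha>) (cech_pb_cpx_mor X I U p q \<alpha>)"
  shows "equivalent_categories (laxholim (cech_diagram X I U W Co Fi))
           (Sh_simplicial X I U :: (('i, 'x, 'r, 'm) simplicial_cpx, _) cat) \<and>
         equivalent_categories (holim (cech_diagram X I U W Co Fi))
           (Sh_cart X I U :: (('i, 'x, 'r, 'm) simplicial_cpx, _) cat)"
proof -
  let ?M = "cech_diagram X I U W Co Fi"
  let ?L = "laxholim ?M" and ?S = "Sh_simplicial X I U :: (('i, 'x, 'r, 'm) simplicial_cpx, _) cat"
  let ?F = "\<lambda>(m, u). \<lparr>lvl = m, act = u\<rparr> :: ('i, 'x, 'r, 'm) simplicial_cpx"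
  note M_simps = cech_diagram_def cech_model_cat_def with_model_structure_def Sh_def
  have Simplex_Obj: "Obj Simplex = UNIV"
    by (simp add: Simplex_def)
  have fctr: "is_functor (cech_model_cat X I U W Co Fi p) (cech_model_cat X I U W Co Fi q)
      (cech_pb_cpx X I U p q \<alpha>) (cech_pb_cpx_mor X I U p q \<alpha>)" if "\<alpha> \<in> Mor Simplex p q" for p q \<alpha>
    using quillen[OF that] by (simp add: left_quillen_def)
  \<comment> \<open>The category laws for complexes of sheaves on each level come with the model
    structures, and functoriality of pullback comes with being left Quillen.\<close>
  have cat: "category ?L"
    using model fctr by (intro category_laxholim) (simp_all add: cech_diagram_def model_category_def)
  \<comment> \<open>The lax limit states coherence as equations between families indexed by the
    degree, the simplicial side degree by degree; \<open>fun_eq_iff\<close> bridges the two, as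
    \<open>pullback_cpx\<close> acts degreewise. Every natural number is an object of
    \<open>Simplex\<close>, so \<open>m\<close> is extensional for free, while \<open>u\<close> and
    \<open>act\<close> share the default \<open>undefined\<close> off the morphisms.\<close>
  have mem: "?F x \<in> Obj ?S \<longleftrightarrow> x \<in> Obj ?L" for x
    by (cases x) (simp add: laxholim_def Sh_simplicial_def laxholim_objects_def is_simplicial_cpx_def
        M_simps Let_def Simplex_Obj PiE_UNIV_domain Pi_iff fun_eq_iff pullback_cpx_def
        pullback_cpx_mor_def conj_ac)
  \<comment> \<open>Reading off the two fields inverts \<open>?F\<close>; since \<open>mem\<close>
    is an equivalence, it yields both inclusions.\<close>
  have bij: "bij_betw ?F (Obj ?L) (Obj ?S)"
  proof (rule bij_betwI[where g = "\<lambda>F. (lvl F, act F)"])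
    show "?F \<in> Obj ?L \<rightarrow> Obj ?S"
      using mem by blast
    show "(\<lambda>F. (lvl F, act F)) \<in> Obj ?S \<rightarrow> Obj ?L"
    proof
      fix F :: "('i, 'x, 'r, 'm) simplicial_cpx"
      assume "F \<in> Obj ?S"
      then show "(lvl F, act F) \<in> Obj ?L"
        using mem[of "(lvl F, act F)"] by (cases F) simp
    qed
  qed auto
  have Mor: "Mor ?S (?F x) (?F y) = Mor ?L x y" for x y
    by (cases x; cases y) (simp add: laxholim_def Sh_simplicial_def simplicial_cpx_hom_def
        M_simps Let_def Simplex_Obj PiE_UNIV_domain Pi_iff fun_eq_iff pullback_cpx_def
        pullback_cpx_mor_def)
  have Ide: "Ide ?S (?F x) = Ide ?L x" for x
    by (cases x) (simp add: laxholim_def Sh_simplicial_def M_simps Let_def Simplex_Obj restrict_UNIV)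
  have Cmp: "Cmp ?S (?F x) (?F y) (?F z) g f = Cmp ?L x y z g f" for x y z g f
    by (cases x; cases y; cases z)
      (simp add: laxholim_def Sh_simplicial_def M_simps Let_def Simplex_Obj restrict_UNIV)
  \<comment> \<open>The hypothesis \<open>weq\<close> speaks of maps between complexes. The source
    here is a pullback, which is a complex because the pullback functor sends objects to
    objects.\<close>
  have quasi_iso_weq: "quasi_iso (cech_nerve X I U q) (cech_pb_cpx X I U p q \<alpha> (m p)) (m q) (u p q \<alpha>)
      \<longleftrightarrow> u p q \<alpha> \<in> W q (cech_pb_cpx X I U p q \<alpha> (m p)) (m q)"
    if L: "(m, u) \<in> Obj ?L" and \<alpha>: "\<alpha> \<in> Mor Simplex p q" for m u p q \<alpha>
  proof -
    have m: "is_sheaf_cpx (cech_nerve X I U p) (m p)" for p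
      using L by (auto simp: laxholim_def laxholim_objects_def M_simps Let_def Simplex_Obj restrict_UNIV)
    have "is_sheaf_cpx (cech_nerve X I U q) (cech_pb_cpx X I U p q \<alpha> (m p))"
      using fctr[OF \<alpha>] m by (simp add: is_functor_def cech_model_cat_def with_model_structure_def Sh_def)
    then show ?thesis
      using m by (simp add: weq)
  qed
  have "equivalent_categories ?L ?S"
    using cat bij Mor Ide Cmp by (rule equivalent_categories_relabel)
  moreover have "equivalent_categories (holim ?M) (Sh_cart X I U :: (('i, 'x, 'r, 'm) simplicial_cpx, _) cat)"
    unfolding holim_def Sh_cart_def using cat bij Mor Ide Cmp
  proof (rule equivalent_full_subcategories_relabel)
    \<comment> \<open>Both conditions range over the same morphisms of \<open>Simplex\<close> and
      concern the same maps, so \<open>quasi_iso_weq\<close> matches them one by one.\<close>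
    fix x assume "x \<in> Obj ?L"
    then show "(\<forall>p q. \<forall>\<alpha>\<in>Mor Simplex p q. quasi_iso (cech_nerve X I U q)
          (cech_pb_cpx X I U p q \<alpha> (lvl (?F x) p)) (lvl (?F x) q) (act (?F x) p q \<alpha>)) \<longleftrightarrow>
        (case x of (m, u) \<Rightarrow> \<forall>d\<in>Obj (shape ?M). \<forall>e\<in>Obj (shape ?M). \<forall>\<theta>\<in>Mor (shape ?M) d e.
          u d e \<theta> \<in> Weq (mcat ?M e) (fobj ?M d e \<theta> (m d)) (m e))"
      by (cases x) (simp add: quasi_iso_weq cech_diagram_def cech_model_cat_def
          with_model_structure_def Simplex_Obj)
  qed
  ultimately show ?thesis ..
qed

end
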